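(* Let $d\ge 3$ be an integer, $d=2k+\epsilon$ with $\epsilon\in\{0,1\}$, let $S_d\subset\mathbb{P}^{k+2}$ be the image of the morphism $\varphi_{I_d}:\mathbb{P}^2\to\mathbb{P}^{k+2}$ associated to the generalized classical Togliatti system $I_d$, and let $I(S_d)\subset R=K[x_0,x_1,\ldots,x_{k+2}]$ be its homogeneous ideal. Then: (1) If $d=2k+1$ is odd, then $I(S_d)=I_2(A)$, where $$A=\begin{pmatrix}x_3&x_4&\cdots&x_{k+1}&x_{k+2}&x_0x_1\\ x_4&x_5&\cdots&x_{k+2}&x_2&x_3^2\end{pmatrix}.$$ In particular, $I(S_d)$ is generated by $\binom{k}{2}$ quadrics and $k$ cubics. (2) If $d=2k$ is even, then $I(S_d)=I_2(B)+(x_0x_1-x_3^2)$, where $$B=\begin{pmatrix}x_3&x_4&\cdots&x_{k+1}&x_{k+2}\\ x_4&x_5&\cdots&x_{k+2}&x_2\end{pmatrix}.$$ In particular, $I(S_d)$ is generated by $1+\binom{k}{2}$ quadrics.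
   Context: $K$ is an algebraically closed field of characteristic zero. The generalized classical Togliatti system is $I_d=(x^d,y^d,z^d,x^ky^kz^{\epsilon},x^{k-1}y^{k-1}z^{\epsilon+2},\ldots,x^2y^2z^{d-4},xyz^{d-2})\subset K[x,y,z]$, and $\varphi_{I_d}$ sends $(x,y,z)$ to $(x^d,y^d,z^d,x^ky^kz^{\epsilon},\ldots,xyz^{d-2})$, with the coordinates $x_0,\ldots,x_{k+2}$ of $\mathbb{P}^{k+2}$ in this order (so $x_0,x_1,x_2$ correspond to $x^d,y^d,z^d$ and $x_{3+i}$ to $x^{k-i}y^{k-i}z^{\epsilon+2i}$ for $0\le i\le k-1$). $I_2(\cdot)$ is the ideal generated by the $2\times2$ minors. The matrix $B$ is $2\times k$, with first row $x_3,x_4,\ldots,x_{k+2}$ and second row $x_4,\ldots,x_{k+2},x_2$; $A$ is the $2\times(k+1)$ matrix obtained by adding the column $(x_0x_1,x_3^2)^T$ to that $2\times k$ matrix. (For $k=1$ the $2\times k$ part is the single column $(x_3,x_2)^T$.) *)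

theory Defs
  imports
    "HOL-Library.Poly_Mapping"
    "HOL-Algebra.Ideal"
    "HOL-Algebra.AbelCoset"
    "Jordan_Normal_Form.Determinant"
    "Jordan_Normal_Form.DL_Submatrix"
begin

section \<open>Polynomial rings in finitely many variables\<close>

text \<open>
  A monomial is a finitely supported exponent function on the variable indices and a polynomial is
  a finitely supported coefficient function on monomials.  The product of
  \<^theory>\<open>HOL-Library.Poly_Mapping\<close> is the convolution product, hence the usual product of polynomials.
\<close>

type_synonym 'a mpoly = "(nat \<Rightarrow>\<^sub>0 nat) \<Rightarrow>\<^sub>0 'a"

definition X :: "nat \<Rightarrow> 'a::field mpoly" where
  "X i = Poly_Mapping.single (Poly_Mapping.single i 1) 1"

definition mon_degree :: "(nat \<Rightarrow>\<^sub>0 nat) \<Rightarrow> nat" where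
  "mon_degree m = (\<Sum>i\<in>Poly_Mapping.keys m. Poly_Mapping.lookup m i)"

definition mpoly_eval :: "'a::field vec \<Rightarrow> 'a mpoly \<Rightarrow> 'a" where
  "mpoly_eval v f = (\<Sum>m\<in>Poly_Mapping.keys f. Poly_Mapping.lookup f m *
     (\<Prod>i\<in>Poly_Mapping.keys m. (v $ i) ^ Poly_Mapping.lookup m i))"

text \<open>The ring \<open>K[x\<^sub>0,\<dots>,x\<^sub>n]\<close> of homogeneous coordinates on \<open>n\<close>-dimensional projective space;
  it has \<open>n + 1\<close> variables.\<close>

definition coord_ring :: "nat \<Rightarrow> 'a::field mpoly ring" where
  "coord_ring n =
     \<lparr>carrier = {f. \<forall>m\<in>Poly_Mapping.keys f. Poly_Mapping.keys m \<subseteq> {..n}},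
      monoid.mult = (*), one = 1, zero = 0, add = (+)\<rparr>"

definition forms :: "nat \<Rightarrow> nat \<Rightarrow> 'a::field mpoly set" where
  "forms n e = {f \<in> carrier (coord_ring n). \<forall>m\<in>Poly_Mapping.keys f. mon_degree m = e}"

text \<open>\<^const>\<open>genideal\<close> is meaningful only in a ring, which is why the following is recorded here.\<close>

lemma coord_ring_simps:
  "f \<in> carrier (coord_ring n) \<longleftrightarrow> (\<forall>m\<in>Poly_Mapping.keys f. Poly_Mapping.keys m \<subseteq> {..n})"
  "f \<otimes>\<^bsub>coord_ring n\<^esub> g = f * g" "\<one>\<^bsub>coord_ring n\<^esub> = 1"
  "\<zero>\<^bsub>coord_ring n\<^esub> = 0" "f \<oplus>\<^bsub>coord_ring n\<^esub> g = f + g"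
  by (simp_all add: coord_ring_def)

lemma coord_ring_add_closed:
  assumes "f \<in> carrier (coord_ring n)" "g \<in> carrier (coord_ring n)"
  shows "f + g \<in> carrier (coord_ring n)"
  using assms Poly_Mapping.keys_add[of f g] unfolding coord_ring_simps(1) by blast

lemma coord_ring_mult_closed:
  assumes "f \<in> carrier (coord_ring n)" "g \<in> carrier (coord_ring n)"
  shows "f * g \<in> carrier (coord_ring n)"
  unfolding coord_ring_simps(1)
proof
  fix m assume "m \<in> Poly_Mapping.keys (f * g)"
  then obtain a b where ab: "m = a + b" "a \<in> Poly_Mapping.keys f" "b \<in> Poly_Mapping.keys g"
    using Poly_Mapping.keys_mult[of f g] by blast
  then show "Poly_Mapping.keys m \<subseteq> {..n}"
    using assms Poly_Mapping.keys_add[of a b] unfolding coord_ring_simps(1) by blast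
qed

lemma coord_ring_zero_one_closed:
  "0 \<in> carrier (coord_ring n)" "1 \<in> carrier (coord_ring n)"
  by (simp_all add: coord_ring_simps(1))

lemma cring_coord_ring: "cring (coord_ring n :: 'a::field mpoly ring)"
proof (rule cringI)
  show "abelian_group (coord_ring n :: 'a mpoly ring)"
  proof (rule abelian_groupI, unfold coord_ring_simps(4,5))
    fix f :: "'a mpoly" assume "f \<in> carrier (coord_ring n)"
    then have "- f \<in> carrier (coord_ring n)" by (simp add: coord_ring_simps(1))
    moreover have "- f + f = 0" by simp
    ultimately show "\<exists>g\<in>carrier (coord_ring n). g + f = 0" by blast
  qed (simp_all add: coord_ring_add_closed coord_ring_zero_one_closed add.assoc add.commute)
  show "comm_monoid (coord_ring n :: 'a mpoly ring)"
    by (rule comm_monoidI, unfold coord_ring_simps(2,3))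
      (simp_all add: coord_ring_mult_closed coord_ring_zero_one_closed mult.assoc mult.commute)
qed (simp add: coord_ring_simps(2,5) distrib_right)


section \<open>Projective space\<close>

definition nonzero_vecs :: "nat \<Rightarrow> 'a::field vec set" where
  "nonzero_vecs n = carrier_vec (n + 1) - {0\<^sub>v (n + 1)}"

definition proj_rel :: "nat \<Rightarrow> ('a::field vec \<times> 'a vec) set" where
  "proj_rel n = {(v, w). v \<in> nonzero_vecs n \<and> w \<in> nonzero_vecs n \<and> (\<exists>c. c \<noteq> 0 \<and> w = c \<cdot>\<^sub>v v)}"

definition proj_space :: "nat \<Rightarrow> 'a::field vec set set" where
  "proj_space n = nonzero_vecs n // proj_rel n"

text \<open>The morphism \<open>[v] \<mapsto> [F\<^sub>0(v) : \<dots> : F\<^sub>N(v)]\<close> given by a list of \<open>N + 1\<close> forms of the same degree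
  without common zero, as the lift to the quotient.\<close>

definition proj_map :: "'a::field mpoly list \<Rightarrow> 'a vec set \<Rightarrow> 'a vec set" where
  "proj_map Fs P =
     (\<Union>v\<in>P. proj_rel (length Fs - 1) `` {vec (length Fs) (\<lambda>j. mpoly_eval v (Fs ! j))})"

definition homogeneous_ideal :: "nat \<Rightarrow> 'a::field vec set set \<Rightarrow> 'a mpoly set" where
  "homogeneous_ideal n S = Idl\<^bsub>coord_ring n\<^esub>
     {f. (\<exists>e. f \<in> forms n e) \<and> (\<forall>P\<in>S. \<forall>v\<in>P. mpoly_eval v f = 0)}"


section \<open>Determinantal ideals\<close>

definition minors :: "nat \<Rightarrow> 'a::field mpoly mat \<Rightarrow> 'a mpoly set" where
  "minors t M = {det (submatrix M I J) | I J.
     I \<subseteq> {..<dim_row M} \<and> J \<subseteq> {..<dim_col M} \<and> card I = t \<and> card J = t}"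

definition minors_ideal :: "nat \<Rightarrow> nat \<Rightarrow> 'a::field mpoly mat \<Rightarrow> 'a mpoly set" where
  "minors_ideal n t M = Idl\<^bsub>coord_ring n\<^esub> (minors t M)"


section \<open>The generalized classical Togliatti system\<close>

text \<open>Here \<open>d = 2 k + \<epsilon>\<close> with \<open>k = d div 2\<close> and \<open>\<epsilon> = d mod 2\<close>, and \<open>x, y, z\<close> are \<open>X 0, X 1, X 2\<close>.
  Entry \<open>j\<close> of the list is the pull-back of the coordinate \<open>x\<^sub>j\<close>.\<close>

definition togliatti_gens :: "nat \<Rightarrow> 'a::field mpoly list" where
  "togliatti_gens d = (let k = d div 2; \<epsilon> = d mod 2 in
     [X 0 ^ d, X 1 ^ d, X 2 ^ d] @
     map (\<lambda>i. X 0 ^ (k - i) * X 1 ^ (k - i) * X 2 ^ (\<epsilon> + 2 * i)) [0..<k])"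

definition togliatti_ideal :: "nat \<Rightarrow> 'a::field mpoly set" where
  "togliatti_ideal d = Idl\<^bsub>coord_ring 2\<^esub> (set (togliatti_gens d))"

definition togliatti_map :: "nat \<Rightarrow> 'a::field vec set \<Rightarrow> 'a vec set" where
  "togliatti_map d = proj_map (togliatti_gens d)"

definition togliatti_variety :: "nat \<Rightarrow> 'a::field vec set set" where
  "togliatti_variety d = togliatti_map d ` proj_space 2"

text \<open>The row lists below are written so that \<open>[4..<k + 3]\<close> is empty for \<open>k = 1\<close>, when \<open>B\<close> is the single
  column \<open>(x\<^sub>3, x\<^sub>2)\<close>.\<close>

definition mat_B :: "nat \<Rightarrow> 'a::field mpoly mat" where
  "mat_B k = mat_of_rows_list k
     [map X [3..<k + 3],
      map X [4..<k + 3] @ [X 2]]"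

definition mat_A :: "nat \<Rightarrow> 'a::field mpoly mat" where
  "mat_A k = mat_of_rows_list (k + 1)
     [map X [3..<k + 3] @ [X 0 * X 1],
      map X [4..<k + 3] @ [X 2, X 3 ^ 2]]"

end

theory Submission
  imports Defs
begin

text \<open>
  Write \<open>y\<^sub>i\<close> for the coordinate pulled back to \<open>(x y)\<^bsup>k-i\<^esup> z\<^bsup>\<epsilon>+2i\<^esup>\<close>, so \<open>y\<^sub>k = x\<^sub>2\<close>.  The surface is
  toric: its ideal is spanned by the differences of monomials of the same degree with the same
  pull-back.  Modulo the quadrics \<open>y\<^sub>i y\<^bsub>j+1\<^esub> - y\<^bsub>i+1\<^esub> y\<^sub>j\<close>, a monomial in the \<open>y\<^sub>i\<close> depends only on its
  degree and its index sum \<open>s\<close>.  In a monomial with exponents \<open>a, b\<close> of \<open>x\<^sub>0, x\<^sub>1\<close>, the difference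
  \<open>a - b\<close> is fixed by the pull-back.  For even \<open>d\<close> the quadric \<open>x\<^sub>0 x\<^sub>1 - y\<^sub>0\<^sup>2\<close> reduces to
  \<open>min a b = 0\<close>, which determines everything.  For odd \<open>d\<close> the degree and the pull-back also fix
  \<open>min a b - s\<close>, and the cubics \<open>x\<^sub>0 x\<^sub>1 y\<^bsub>i+1\<^esub> - y\<^sub>0\<^sup>2 y\<^sub>i\<close> lower \<open>min a b\<close> and \<open>s\<close> together until one of
  them is zero.
\<close>

section \<open>Degree and evaluation\<close>

lemma keys_plus_nat:
  "Poly_Mapping.keys (a + b) = Poly_Mapping.keys a \<union> Poly_Mapping.keys (b :: 'i \<Rightarrow>\<^sub>0 nat)"
  by (auto simp: in_keys_iff lookup_add)

text \<open>Degree and evaluation range over the support of a monomial; passing to a larger finite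
  set lets two monomials be treated over a common index set.\<close>

lemma mon_degree_superset:
  assumes "finite A" "Poly_Mapping.keys m \<subseteq> A"
  shows "mon_degree m = (\<Sum>i\<in>A. Poly_Mapping.lookup m i)"
  unfolding mon_degree_def using assms by (intro sum.mono_neutral_left) (auto simp: in_keys_iff)

lemma mon_degree_add: "mon_degree (a + b) = mon_degree a + mon_degree b"
proof -
  let ?A = "Poly_Mapping.keys a \<union> Poly_Mapping.keys b"
  have "mon_degree (a + b) = (\<Sum>i\<in>?A. Poly_Mapping.lookup (a + b) i)"
    by (simp add: mon_degree_superset[of ?A] keys_plus_nat)
  also have "\<dots> = mon_degree a + mon_degree b"
    by (simp add: mon_degree_superset[of ?A] lookup_add sum.distrib)
  finally show ?thesis .
qed

lemma mon_degree_zero [simp]: "mon_degree 0 = 0"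
  by (simp add: mon_degree_def)

lemma mon_degree_single [simp]: "mon_degree (Poly_Mapping.single i e) = e"
  by (simp add: mon_degree_def)

definition mon_eval :: "'a::field vec \<Rightarrow> (nat \<Rightarrow>\<^sub>0 nat) \<Rightarrow> 'a" where
  "mon_eval v m = (\<Prod>i\<in>Poly_Mapping.keys m. (v $ i) ^ Poly_Mapping.lookup m i)"

lemma mon_eval_superset:
  assumes "finite A" "Poly_Mapping.keys m \<subseteq> A"
  shows "mon_eval v m = (\<Prod>i\<in>A. (v $ i) ^ Poly_Mapping.lookup m i)"
  unfolding mon_eval_def using assms by (intro prod.mono_neutral_left) (auto simp: in_keys_iff)

lemma mon_eval_add: "mon_eval v (a + b) = mon_eval v a * mon_eval v b"
proof -
  let ?A = "Poly_Mapping.keys a \<union> Poly_Mapping.keys b"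
  have "mon_eval v (a + b) = (\<Prod>i\<in>?A. (v $ i) ^ Poly_Mapping.lookup (a + b) i)"
    by (simp add: mon_eval_superset[of ?A] keys_plus_nat)
  also have "\<dots> = mon_eval v a * mon_eval v b"
    by (simp add: mon_eval_superset[of ?A] lookup_add power_add prod.distrib)
  finally show ?thesis .
qed

lemma mpoly_eval_superset:
  assumes "finite A" "Poly_Mapping.keys f \<subseteq> A"
  shows "mpoly_eval v f = (\<Sum>m\<in>A. Poly_Mapping.lookup f m * mon_eval v m)"
  unfolding mpoly_eval_def mon_eval_def
  using assms by (intro sum.mono_neutral_left) (auto simp: in_keys_iff)

lemma mpoly_eval_zero [simp]: "mpoly_eval v 0 = 0"
  by (simp add: mpoly_eval_def)

lemma mpoly_eval_add [simp]: "mpoly_eval v (f + g) = mpoly_eval v f + mpoly_eval v g"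
proof -
  let ?A = "Poly_Mapping.keys f \<union> Poly_Mapping.keys g"
  have "mpoly_eval v (f + g) = (\<Sum>m\<in>?A. Poly_Mapping.lookup (f + g) m * mon_eval v m)"
    by (rule mpoly_eval_superset) (use Poly_Mapping.keys_add[of f g] in auto)
  also have "\<dots> = mpoly_eval v f + mpoly_eval v g"
    by (simp add: mpoly_eval_superset[of ?A] lookup_add distrib_right sum.distrib)
  finally show ?thesis .
qed

lemma mpoly_eval_uminus [simp]: "mpoly_eval v (- f) = - mpoly_eval v f"
  using mpoly_eval_add[of v f "- f"] by (simp add: add_eq_0_iff)

lemma mpoly_eval_diff [simp]: "mpoly_eval v (f - g) = mpoly_eval v f - mpoly_eval v g"
  using mpoly_eval_add[of v f "- g"] by simp

lemma mpoly_eval_sum [simp]: "mpoly_eval v (sum F A) = (\<Sum>a\<in>A. mpoly_eval v (F a))"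
  by (induction A rule: infinite_finite_induct) auto

lemma mpoly_eval_single: "mpoly_eval v (Poly_Mapping.single m c) = c * mon_eval v m"
  by (simp add: mpoly_eval_superset[of "{m}"])

lemma sum_single_lookup:
  "(\<Sum>m\<in>Poly_Mapping.keys f. Poly_Mapping.single m (Poly_Mapping.lookup f m)) = f"
  by (intro poly_mapping_eqI)
    (auto simp: lookup_sum lookup_single when_def not_in_keys_iff_lookup_eq_zero)

lemma single_sum: "Poly_Mapping.single m (sum c A) = (\<Sum>a\<in>A. Poly_Mapping.single m (c a))"
  by (induction A rule: infinite_finite_induct) (auto simp: single_add)

lemma mpoly_eval_mult [simp]: "mpoly_eval v (f * g) = mpoly_eval v f * mpoly_eval v g"
proof -
  let ?s = "\<lambda>h m. Poly_Mapping.single m (Poly_Mapping.lookup h m)"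
  have ev: "mpoly_eval v h = (\<Sum>m\<in>Poly_Mapping.keys h. mpoly_eval v (?s h m))" for h :: "'a mpoly"
    by (simp add: mpoly_eval_single mpoly_eval_superset[of "Poly_Mapping.keys h"])
  have "f * g = (\<Sum>m\<in>Poly_Mapping.keys f. ?s f m) * (\<Sum>m\<in>Poly_Mapping.keys g. ?s g m)"
    by (simp add: sum_single_lookup)
  also have "\<dots> = (\<Sum>m\<in>Poly_Mapping.keys f. \<Sum>n\<in>Poly_Mapping.keys g.
      Poly_Mapping.single (m + n) (Poly_Mapping.lookup f m * Poly_Mapping.lookup g n))"
    by (simp add: sum_product mult_single)
  finally have "mpoly_eval v (f * g) = (\<Sum>m\<in>Poly_Mapping.keys f. \<Sum>n\<in>Poly_Mapping.keys g.
      mpoly_eval v (?s f m) * mpoly_eval v (?s g n))"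
    by (simp add: mpoly_eval_single mon_eval_add mult_ac)
  then show ?thesis
    by (simp add: ev[of f] ev[of g] sum_product)
qed

lemma mpoly_eval_one [simp]: "mpoly_eval v 1 = 1"
  unfolding single_one[symmetric] mpoly_eval_single by (simp add: mon_eval_def)

lemma mpoly_eval_power [simp]: "mpoly_eval v (f ^ n) = mpoly_eval v f ^ n"
  by (induction n) auto

lemma mpoly_eval_X [simp]: "mpoly_eval v (X i) = v $ i"
  by (simp add: X_def mpoly_eval_single mon_eval_def)

lemma mpoly_eval_prod_mset [simp]:
  "mpoly_eval v (\<Prod>i\<in>#M. F i) = (\<Prod>i\<in>#M. mpoly_eval v (F i))"
  by (induction M) auto

section \<open>Homogeneous forms and induction on monomials\<close>

lemma forms_subset_carrier: "forms n e \<subseteq> carrier (coord_ring n)"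
  by (auto simp: forms_def)

lemma forms_mult:
  assumes "f \<in> forms n a" "g \<in> forms n b"
  shows "f * g \<in> forms n (a + b)"
  using assms Poly_Mapping.keys_mult[of f g]
  by (fastforce simp: forms_def coord_ring_mult_closed mon_degree_add)

lemma forms_diff:
  assumes "f \<in> forms n a" "g \<in> forms n a"
  shows "f - g \<in> forms n a"
  using assms Poly_Mapping.keys_diff[of f g] unfolding forms_def coord_ring_simps(1) by blast

lemma X_form: "i \<le> n \<Longrightarrow> X i \<in> forms n 1"
  by (auto simp: forms_def coord_ring_simps(1) X_def)

lemma X_mult_form: "i \<le> n \<Longrightarrow> j \<le> n \<Longrightarrow> X i * X j \<in> forms n 2"
  using forms_mult[OF X_form X_form, of i n j] by (simp add: numeral_2_eq_2)

lemma X_mult3_form: "i \<le> n \<Longrightarrow> j \<le> n \<Longrightarrow> l \<le> n \<Longrightarrow> X i * (X j * X l) \<in> forms n 3"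
  using forms_mult[OF X_form X_mult_form, of i n j l] by (simp add: numeral_3_eq_3)

lemma X_carrier: "i \<le> n \<Longrightarrow> X i \<in> carrier (coord_ring n)"
  using X_form forms_subset_carrier by blast

lemma single_mult_X:
  "Poly_Mapping.single (Poly_Mapping.single i 1 + m) (1::'a::field)
     = X i * Poly_Mapping.single m 1"
  by (simp add: X_def mult_single)

lemma monomial_induct [consumes 1, case_names zero mult]:
  assumes "Poly_Mapping.keys (m :: nat \<Rightarrow>\<^sub>0 nat) \<subseteq> A"
    and "P 0"
    and step: "\<And>i m. i \<in> A \<Longrightarrow> Poly_Mapping.keys m \<subseteq> A \<Longrightarrow> P m \<Longrightarrow> P (Poly_Mapping.single i 1 + m)"
  shows "P m"
  using assms(1)
proof (induction "mon_degree m" arbitrary: m rule: less_induct)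
  case less
  show ?case
  proof (cases "m = 0")
    case True
    then show ?thesis using assms(2) by simp
  next
    case False
    then obtain i where i: "i \<in> Poly_Mapping.keys m"
      by (metis lookup_zero not_in_keys_iff_lookup_eq_zero poly_mapping_eqI)
    define m' where "m' = m - Poly_Mapping.single i 1"
    have m: "m = Poly_Mapping.single i 1 + m'"
      using i by (intro poly_mapping_eqI)
        (auto simp: m'_def lookup_add lookup_minus lookup_single when_def in_keys_iff)
    have "mon_degree m' < mon_degree m" "Poly_Mapping.keys m' \<subseteq> A"
      using less.prems by (auto simp: m mon_degree_add keys_plus_nat)
    then have "P (Poly_Mapping.single i 1 + m')"
      using i less by (intro step) auto
    then show ?thesis using m by simp
  qed
qed

section \<open>Congruences modulo an ideal\<close>

text \<open>
  Ideals of \<^const>\<open>coord_ring\<close> are handled as subsets of the type of all polynomials, so that the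
  class-based arithmetic stays available.
\<close>

locale poly_ideal =
  fixes n :: nat and I :: "'a::field mpoly set"
  assumes ideal: "ideal I (coord_ring n)"
begin

lemma zero_mem: "0 \<in> I"
  using additive_subgroup.zero_closed[OF ideal.axioms(1)[OF ideal]] by (simp add: coord_ring_simps)

lemma add_mem: "f \<in> I \<Longrightarrow> g \<in> I \<Longrightarrow> f + g \<in> I"
  using additive_subgroup.a_closed[OF ideal.axioms(1)[OF ideal], of f g]
  by (simp add: coord_ring_simps)

lemma mult_mem: "f \<in> carrier (coord_ring n) \<Longrightarrow> g \<in> I \<Longrightarrow> f * g \<in> I"
  using ideal.I_l_closed[OF ideal, of g f] by (simp add: coord_ring_simps)

lemma uminus_mem: "f \<in> I \<Longrightarrow> - f \<in> I"
  using mult_mem[of "- 1" f] by (simp add: coord_ring_simps(1))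

lemma sum_mem: "(\<And>a. a \<in> A \<Longrightarrow> F a \<in> I) \<Longrightarrow> sum F A \<in> I"
  by (induction A rule: infinite_finite_induct) (auto intro: zero_mem add_mem)

definition cong :: "'a mpoly \<Rightarrow> 'a mpoly \<Rightarrow> bool" where
  "cong f g \<longleftrightarrow> f - g \<in> I"

lemma cong_refl: "cong f f"
  by (simp add: cong_def zero_mem)

lemma cong_sym: "cong f g \<Longrightarrow> cong g f"
  using uminus_mem[of "f - g"] by (simp add: cong_def)

lemma cong_trans [trans]: "cong f g \<Longrightarrow> cong g h \<Longrightarrow> cong f h"
  using add_mem[of "f - g" "g - h"] by (simp add: cong_def)

lemma cong_mult: "cong f g \<Longrightarrow> r \<in> carrier (coord_ring n) \<Longrightarrow> cong (r * f) (r * g)"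
  using mult_mem[of r "f - g"] by (simp add: cong_def right_diff_distrib)

text \<open>Grouping the terms of \<open>f\<close> by the exponent \<open>w\<close> of their image, every group is a combination
  with coefficient sum zero of pairwise congruent monomials.\<close>

lemma mem_if_vanishing_on_curve:
  fixes w :: "(nat \<Rightarrow>\<^sub>0 nat) \<Rightarrow> nat"
  assumes inf: "infinite (UNIV :: 'a set)"
    and cong: "\<And>m m'. m \<in> Poly_Mapping.keys f \<Longrightarrow> m' \<in> Poly_Mapping.keys f \<Longrightarrow> w m = w m' \<Longrightarrow>
      cong (Poly_Mapping.single m 1) (Poly_Mapping.single m' 1)"
    and van: "\<And>t. (\<Sum>m\<in>Poly_Mapping.keys f. Poly_Mapping.lookup f m * t ^ w m) = 0"
  shows "f \<in> I"
proof -
  define K where "K = Poly_Mapping.keys f"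
  let ?c = "Poly_Mapping.lookup f"
  \<comment> \<open>\<open>p\<close> is the restriction of \<open>f\<close> to the curve. It
    vanishes at every point of an infinite field, so the coefficients of \<open>f\<close> sum to
    zero over each set of monomials with the same \<open>w\<close>.\<close>
  define p where "p = (\<Sum>m\<in>K. monom (?c m) (w m))"
  have "poly p t = 0" for t
    using van[of t] by (simp add: p_def K_def poly_sum poly_monom)
  then have "p = 0"
    using inf poly_roots_finite[of p] by auto
  have csum: "(\<Sum>m\<in>{m \<in> K. w m = j}. ?c m) = 0" for j
  proof -
    have "(\<Sum>m\<in>{m \<in> K. w m = j}. ?c m) = coeff p j"
      by (simp add: p_def coeff_sum coeff_monom K_def sum.inter_filter)
    then show ?thesis using \<open>p = 0\<close> by simp
  qed
  have group: "(\<Sum>m\<in>{m \<in> K. w m = j}. Poly_Mapping.single m (?c m)) \<in> I" if "j \<in> w ` K" for j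
  proof -
    from that obtain r where r: "r \<in> K" "w r = j" by auto
    \<comment> \<open>Each term is compared with a multiple of the fixed monomial \<open>r\<close>;
      what is left over is \<open>r\<close> times the coefficient sum of the group, which is
      zero.\<close>
    have "(\<Sum>m\<in>{m \<in> K. w m = j}. Poly_Mapping.single m (?c m))
      = (\<Sum>m\<in>{m \<in> K. w m = j}. Poly_Mapping.single 0 (?c m) *
          (Poly_Mapping.single m 1 - Poly_Mapping.single r 1))
        + (\<Sum>m\<in>{m \<in> K. w m = j}. Poly_Mapping.single r (?c m))"
      by (simp add: sum.distrib[symmetric] right_diff_distrib mult_single)
    also have "(\<Sum>m\<in>{m \<in> K. w m = j}. Poly_Mapping.single r (?c m)) = 0"
      using csum[of j] by (simp add: single_sum[symmetric])
    finally show ?thesis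
      using r cong by (auto intro!: sum_mem mult_mem simp: cong_def K_def coord_ring_simps(1))
  qed
  have "f = (\<Sum>m\<in>K. Poly_Mapping.single m (?c m))"
    by (simp add: K_def sum_single_lookup)
  also have "\<dots> = (\<Sum>j\<in>w ` K. \<Sum>m\<in>{m \<in> K. w m = j}. Poly_Mapping.single m (?c m))"
    by (rule sum.image_gen) (simp add: K_def)
  also have "\<dots> \<in> I"
    by (intro sum_mem group)
  finally show ?thesis .
qed

end

lemma poly_ideal_Idl: "G \<subseteq> carrier (coord_ring n) \<Longrightarrow> poly_ideal n (Idl\<^bsub>coord_ring n\<^esub> G)"
  using ring.genideal_ideal[OF cring.axioms(1)[OF cring_coord_ring]] by (simp add: poly_ideal_def)

section \<open>Binomial relations\<close>

lemma power_carrier: "f \<in> carrier (coord_ring n) \<Longrightarrow> f ^ e \<in> carrier (coord_ring n)"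
  by (induction e) (auto simp: coord_ring_mult_closed coord_ring_zero_one_closed)

lemma prod_mset_carrier:
  "(\<And>i. i \<in># M \<Longrightarrow> F i \<in> carrier (coord_ring n)) \<Longrightarrow> (\<Prod>i\<in>#M. F i) \<in> carrier (coord_ring n)"
  by (induction M) (auto simp: coord_ring_mult_closed coord_ring_zero_one_closed)

text \<open>\<open>Y k 0, \<dots>, Y k k\<close> is \<open>x\<^sub>3, \<dots>, x\<^bsub>k+2\<^esub>, x\<^sub>2\<close>; the pull-back of \<open>Y k i\<close> is
  \<open>(x y)\<^bsup>k-i\<^esup> z\<^bsup>\<epsilon>+2i\<^esup>\<close> for all \<open>i \<le> k\<close>.\<close>

definition Y_index :: "nat \<Rightarrow> nat \<Rightarrow> nat" where
  "Y_index k i = (if i < k then i + 3 else 2)"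

definition Y :: "nat \<Rightarrow> nat \<Rightarrow> 'a::field mpoly" where
  "Y k i = X (Y_index k i)"

lemma Y_index_le: "Y_index k i \<le> k + 2"
  by (simp add: Y_index_def)

lemma Y_carrier: "Y k i \<in> carrier (coord_ring (k + 2))"
  unfolding Y_def by (rule X_carrier) (rule Y_index_le)

text \<open>The y-part is a multiset of indices rather than an exponent vector: its degree is
  \<open>size M\<close>, its index sum is \<open>\<Sum>\<^sub># M\<close>, and a relation replaces a
  few elements.\<close>

definition Y_monomial :: "nat \<Rightarrow> nat \<Rightarrow> nat \<Rightarrow> nat multiset \<Rightarrow> 'a::field mpoly" where
  "Y_monomial k a b M = X 0 ^ a * X 1 ^ b * (\<Prod>i\<in>#M. Y k i)"

text \<open>For indices at most \<open>k\<close> this is the exponent of x, and equally of y, in the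
  pull-back of the product of the \<open>Y k i\<close> over \<open>M\<close>.\<close>

definition Y_weight :: "nat \<Rightarrow> nat multiset \<Rightarrow> nat" where
  "Y_weight k M = (\<Sum>i\<in>#M. k - i)"

lemma Y_weight_simps [simp]:
  "Y_weight k {#} = 0" "Y_weight k (add_mset i M) = (k - i) + Y_weight k M"
  by (simp_all add: Y_weight_def)

text \<open>Each index i contributes (k - i) + i = k. At fixed size, weight and index sum therefore
  determine each other.\<close>

lemma Y_weight_plus_sum: "set_mset M \<subseteq> {..k} \<Longrightarrow> Y_weight k M + \<Sum>\<^sub># M = k * size M"
  by (induction M) auto

lemma single_eq_Y_monomial:
  assumes "Poly_Mapping.keys m \<subseteq> {..k + 2}"
  shows "\<exists>a b M. set_mset M \<subseteq> {..k} \<and> mon_degree m = a + b + size M \<and>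
    Poly_Mapping.single m 1 = (Y_monomial k a b M :: 'a::field mpoly)"
  using assms
proof (induction rule: monomial_induct)
  case zero
  show ?case
    by (rule exI[of _ 0], rule exI[of _ 0], rule exI[of _ "{#}"]) (simp add: Y_monomial_def)
next
  case (mult i m)
  then obtain a b M where IH: "set_mset M \<subseteq> {..k}" "mon_degree m = a + b + size M"
    "Poly_Mapping.single m 1 = (Y_monomial k a b M :: 'a mpoly)" by blast
  let ?m = "Poly_Mapping.single i 1 + m"
  have deg: "mon_degree ?m = Suc (mon_degree m)"
    by (simp add: mon_degree_add)
  consider "i = 0" | "i = 1" | j where "j \<le> k" "i = Y_index k j"
  proof -
    \<comment> \<open>Variable 2 sits at the end of the sequence of the y's, as
      \<open>Y k k\<close>; a variable 3 or later is shifted by three.\<close>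
    have "i = Y_index k (if i = 2 then k else i - 3)" "(if i = 2 then k else i - 3) \<le> k"
      if "i \<noteq> 0" "i \<noteq> 1"
      using that mult.hyps(1) by (auto simp: Y_index_def)
    then show ?thesis using that by blast
  qed
  then show ?case
  proof cases
    case 1
    then have "Poly_Mapping.single ?m 1 = (Y_monomial k (Suc a) b M :: 'a mpoly)"
      by (simp only: single_mult_X IH(3)) (simp add: Y_monomial_def mult_ac)
    then show ?thesis using IH(1,2) deg
      by (intro exI[of _ "Suc a"] exI[of _ b] exI[of _ M]) simp
  next
    case 2
    then have "Poly_Mapping.single ?m 1 = (Y_monomial k a (Suc b) M :: 'a mpoly)"
      by (simp only: single_mult_X IH(3)) (simp add: Y_monomial_def mult_ac)
    then show ?thesis using IH(1,2) deg
      by (intro exI[of _ a] exI[of _ "Suc b"] exI[of _ M]) simp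
  next
    case (3 j)
    then have "Poly_Mapping.single ?m 1 = (Y_monomial k a b (add_mset j M) :: 'a mpoly)"
      by (simp only: single_mult_X IH(3)) (simp add: Y_monomial_def Y_def mult_ac)
    then show ?thesis using IH(1,2) deg 3
      by (intro exI[of _ a] exI[of _ b] exI[of _ "add_mset j M"]) simp
  qed
qed

section \<open>Products of the y's modulo the quadrics of the rational normal curve\<close>

locale curve_ideal = poly_ideal "k + 2" I for k :: nat and I :: "'a::field mpoly set" +
  assumes quadric: "i < j \<Longrightarrow> j < k \<Longrightarrow> Y k i * Y k (Suc j) - Y k (Suc i) * Y k j \<in> I"
begin

text \<open>The quadrics are assumed for \<open>i < j\<close> only. The case i = j is trivial, and i
  > j is the same relation with its sides exchanged.\<close>

lemma quadric_cong:
  assumes "i < k" "j < k"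
  shows "cong (Y k i * Y k (Suc j)) (Y k (Suc i) * Y k j)"
proof (cases i j rule: linorder_cases)
  case less
  then show ?thesis using quadric assms by (simp add: cong_def)
next
  case equal
  then show ?thesis using cong_refl by (simp add: mult.commute)
next
  case greater
  then have "cong (Y k j * Y k (Suc i)) (Y k (Suc j) * Y k i)"
    using quadric assms by (simp add: cong_def)
  then show ?thesis using cong_sym by (simp add: mult.commute)
qed

lemma prod_Y_carrier: "(\<Prod>i\<in>#M. Y k i) \<in> carrier (coord_ring (k + 2))"
  by (rule prod_mset_carrier) (rule Y_carrier)

text \<open>One factor moves up an index while another moves down. The bound
  \<open>j < \<Sum>\<^sub># M\<close> guarantees a second factor with positive index to move
  down.\<close>

lemma prod_Y_raise_step:
  assumes M: "set_mset M \<subseteq> {..k}" and j: "j \<in># M" "j < k" "j < \<Sum>\<^sub># M"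
  shows "\<exists>M'. set_mset M' \<subseteq> {..k} \<and> size M' = size M \<and> \<Sum>\<^sub># M' = \<Sum>\<^sub># M \<and> Suc j \<in># M' \<and>
    cong (\<Prod>i\<in>#M. Y k i) (\<Prod>i\<in>#M'. Y k i)"
proof -
  obtain N where N: "M = add_mset j N" using j(1) by (metis mset_add)
  have "\<Sum>\<^sub># M = j + \<Sum>\<^sub># N" by (simp add: N)
  with j(3) have "\<Sum>\<^sub># N \<noteq> 0" by linarith
  then obtain i where "i \<in># N" "i \<noteq> 0" unfolding sum_mset_0_iff by blast
  then obtain i' where "Suc i' \<in># N" by (cases i) auto
  then obtain L where L: "N = add_mset (Suc i') L" by (metis mset_add)
  have "i' < k" using M by (simp add: N L)
  then have "cong ((\<Prod>i\<in>#L. Y k i) * (Y k j * Y k (Suc i')))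
      ((\<Prod>i\<in>#L. Y k i) * (Y k (Suc j) * Y k i'))"
    by (intro cong_mult quadric_cong prod_Y_carrier j)
  then show ?thesis
    using M j(2) by (intro exI[of _ "add_mset (Suc j) (add_mset i' L)"]) (auto simp: N L mult_ac)
qed

text \<open>Repeated raising produces a factor whose index depends on the index sum alone, and
  splits it off.\<close>

lemma prod_Y_raise:
  assumes M: "set_mset M \<subseteq> {..k}" "M \<noteq> {#}"
  shows "\<exists>N. set_mset N \<subseteq> {..k} \<and> Suc (size N) = size M \<and> min k (\<Sum>\<^sub># M) + \<Sum>\<^sub># N = \<Sum>\<^sub># M \<and>
    cong (\<Prod>i\<in>#M. Y k i) (Y k (min k (\<Sum>\<^sub># M)) * (\<Prod>i\<in>#N. Y k i))"
proof -
  let ?s = "\<Sum>\<^sub># M"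
  obtain j where j: "j \<in># M" using M(2) by auto
  then obtain L where "M = add_mset j L" by (metis mset_add)
  \<comment> \<open>Any factor can serve as the starting point: its index is at most
    \<open>k\<close> and at most the whole sum, and is raised one unit at a time up to the
    minimum.\<close>
  then have "j \<le> min k ?s" using M(1) by auto
  then have "\<exists>M'. set_mset M' \<subseteq> {..k} \<and> size M' = size M \<and> \<Sum>\<^sub># M' = ?s \<and> min k ?s \<in># M' \<and>
    cong (\<Prod>i\<in>#M. Y k i) (\<Prod>i\<in>#M'. Y k i)"
  proof (induction rule: dec_induct)
    case base
    then show ?case using M(1) j cong_refl by blast
  next
    case (step l)
    then obtain M' where M': "set_mset M' \<subseteq> {..k}" "size M' = size M" "\<Sum>\<^sub># M' = ?s" "l \<in># M'"
      "cong (\<Prod>i\<in>#M. Y k i) (\<Prod>i\<in>#M'. Y k i)" by blast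
    with step.hyps obtain M'' where M'': "set_mset M'' \<subseteq> {..k}" "size M'' = size M'"
      "\<Sum>\<^sub># M'' = \<Sum>\<^sub># M'" "Suc l \<in># M''" "cong (\<Prod>i\<in>#M'. Y k i) (\<Prod>i\<in>#M''. Y k i)"
      using prod_Y_raise_step[of M' l] by auto
    have "cong (\<Prod>i\<in>#M. Y k i) (\<Prod>i\<in>#M''. Y k i)"
      using M'(5) M''(5) by (rule cong_trans)
    then show ?case using M' M'' by (intro exI[of _ M'']) simp
  qed
  then obtain M' where M': "set_mset M' \<subseteq> {..k}" "size M' = size M" "\<Sum>\<^sub># M' = ?s"
      "min k ?s \<in># M'" "cong (\<Prod>i\<in>#M. Y k i) (\<Prod>i\<in>#M'. Y k i)" by blast
  then obtain N where "M' = add_mset (min k ?s) N" by (metis mset_add)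
  with M' show ?thesis by (intro exI[of _ N]) auto
qed

text \<open>Both products split off the same factor; the remaining products again have equal size
  and equal index sum, so induction on the size applies.\<close>

lemma prod_Y_cong:
  assumes "set_mset M \<subseteq> {..k}" "set_mset M' \<subseteq> {..k}" "size M = size M'" "\<Sum>\<^sub># M = \<Sum>\<^sub># M'"
  shows "cong (\<Prod>i\<in>#M. Y k i) (\<Prod>i\<in>#M'. Y k i)"
  using assms
proof (induction "size M" arbitrary: M M')
  case 0
  then show ?case by (simp add: cong_refl)
next
  case (Suc n)
  let ?j = "min k (\<Sum>\<^sub># M)"
  from Suc obtain N where N: "set_mset N \<subseteq> {..k}" "Suc (size N) = size M" "?j + \<Sum>\<^sub># N = \<Sum>\<^sub># M"
    "cong (\<Prod>i\<in>#M. Y k i) (Y k ?j * (\<Prod>i\<in>#N. Y k i))"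
    using prod_Y_raise[of M] by force
  from Suc obtain N' where N': "set_mset N' \<subseteq> {..k}" "Suc (size N') = size M" "?j + \<Sum>\<^sub># N' = \<Sum>\<^sub># M"
    "cong (\<Prod>i\<in>#M'. Y k i) (Y k ?j * (\<Prod>i\<in>#N'. Y k i))"
    using prod_Y_raise[of M'] by force
  have "cong (\<Prod>i\<in>#N. Y k i) (\<Prod>i\<in>#N'. Y k i)"
    using N N' Suc by (intro Suc.hyps(1)) auto
  then have "cong (Y k ?j * (\<Prod>i\<in>#N. Y k i)) (Y k ?j * (\<Prod>i\<in>#N'. Y k i))"
    by (intro cong_mult Y_carrier)
  with N(4) N'(4) show ?case by (meson cong_sym cong_trans)
qed

lemma Y_monomial_cong:
  assumes "cong (\<Prod>i\<in>#M. Y k i) (\<Prod>i\<in>#M'. Y k i)"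
  shows "cong (Y_monomial k a b M) (Y_monomial k a b M')"
  unfolding Y_monomial_def using assms
  by (intro cong_mult coord_ring_mult_closed power_carrier X_carrier) auto

end

section \<open>Lowering the common power of x_0 and x_1\<close>

text \<open>Induction on \<open>a\<close>. Each use of a cubic trades x_0 x_1 y_{i+1} for y_0^2 y_i,
  lowering \<open>a\<close>, \<open>b\<close> and the index sum by one, until one of them is
  zero.\<close>

lemma (in curve_ideal) odd_reduce:
  assumes cubic: "\<And>i. i < k \<Longrightarrow> Y k i * Y k 0 ^ 2 - Y k (Suc i) * (X 0 * X 1) \<in> I"
    and M: "set_mset M \<subseteq> {..k}"
  shows "\<exists>a' b' M'. set_mset M' \<subseteq> {..k} \<and> a' + b' + size M' = a + b + size M \<and>
    (2 * k + 1) * a' + Y_weight k M' = (2 * k + 1) * a + Y_weight k M \<and>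
    (2 * k + 1) * b' + Y_weight k M' = (2 * k + 1) * b + Y_weight k M \<and>
    (a' = 0 \<or> b' = 0 \<or> \<Sum>\<^sub># M' = 0) \<and> cong (Y_monomial k a b M) (Y_monomial k a' b' M')"
  using M
proof (induction a arbitrary: b M)
  case 0
  show ?case using 0 cong_refl by blast
next
  case (Suc a)
  show ?case
  proof (cases "b = 0 \<or> \<Sum>\<^sub># M = 0")
    case True
    then show ?thesis using Suc.prems cong_refl by blast
  next
    case False
    then obtain b' where b: "b = Suc b'" by (cases b) auto
    from False obtain i where "i \<in># M" "i \<noteq> 0" by (auto simp: sum_mset_0_iff)
    then obtain i' where "Suc i' \<in># M" by (cases i) auto
  then obtain L where L: "M = add_mset (Suc i') L" by (metis mset_add)
    have i': "i' < k" using Suc.prems by (simp add: L)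
    let ?M = "add_mset 0 (add_mset 0 (add_mset i' L))"
    have "cong (Y k (Suc i') * (X 0 * X 1)) (Y k i' * Y k 0 ^ 2)"
      using cubic[OF i'] cong_sym by (simp add: cong_def)
    then have "cong (Y_monomial k a b' L * (Y k (Suc i') * (X 0 * X 1)))
        (Y_monomial k a b' L * (Y k i' * Y k 0 ^ 2))"
      unfolding Y_monomial_def
      by (intro cong_mult coord_ring_mult_closed power_carrier X_carrier prod_Y_carrier) auto
    then have c: "cong (Y_monomial k (Suc a) b M) (Y_monomial k a b' ?M)"
      by (simp add: Y_monomial_def b L mult_ac power2_eq_square)
    have "set_mset ?M \<subseteq> {..k}" using Suc.prems i' by (auto simp: L)
    from Suc.IH[OF this, of b'] obtain a'' b'' M'' where *: "set_mset M'' \<subseteq> {..k}"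
      "a'' + b'' + size M'' = a + b' + size ?M"
      "(2 * k + 1) * a'' + Y_weight k M'' = (2 * k + 1) * a + Y_weight k ?M"
      "(2 * k + 1) * b'' + Y_weight k M'' = (2 * k + 1) * b' + Y_weight k ?M"
      "a'' = 0 \<or> b'' = 0 \<or> \<Sum>\<^sub># M'' = 0" "cong (Y_monomial k a b' ?M) (Y_monomial k a'' b'' M'')"
      by blast
    \<comment> \<open>The two new zeros add \<open>2 * k\<close> to the weight and the lowered index
      adds one, which compensates for the loss of one in \<open>a\<close> and in \<open>b\<close>,
      each counted \<open>2 * k + 1\<close> times.\<close>
    have "(2 * k + 1) * a + Y_weight k ?M = (2 * k + 1) * Suc a + Y_weight k M"
      "(2 * k + 1) * b' + Y_weight k ?M = (2 * k + 1) * b + Y_weight k M"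
      using i' by (auto simp: L b)
    moreover have "cong (Y_monomial k (Suc a) b M) (Y_monomial k a'' b'' M'')"
      using c *(6) by (rule cong_trans)
    moreover have "a'' + b'' + size M'' = Suc a + b + size M"
      using *(2) by (simp add: L b)
    ultimately show ?thesis using *(1,3,4,5) by metis
  qed
qed

text \<open>Here x_0 x_1 is traded for y_0^2 without consuming a y-factor, so the process stops only
  when \<open>a\<close> or \<open>b\<close> is zero. The two new zeros add \<open>2 * k\<close> to
  the weight.\<close>

lemma (in curve_ideal) even_reduce:
  assumes quadric': "X 0 * X 1 - Y k 0 ^ 2 \<in> I"
    and M: "set_mset M \<subseteq> {..k}"
  shows "\<exists>a' b' M'. set_mset M' \<subseteq> {..k} \<and> a' + b' + size M' = a + b + size M \<and>
    2 * k * a' + Y_weight k M' = 2 * k * a + Y_weight k M \<and>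
    2 * k * b' + Y_weight k M' = 2 * k * b + Y_weight k M \<and>
    (a' = 0 \<or> b' = 0) \<and> cong (Y_monomial k a b M) (Y_monomial k a' b' M')"
  using M
proof (induction a arbitrary: b M)
  case 0
  show ?case using 0 cong_refl by blast
next
  case (Suc a)
  show ?case
  proof (cases "b = 0")
    case True
    then show ?thesis using Suc.prems cong_refl by blast
  next
    case False
    then obtain b' where b: "b = Suc b'" by (cases b) auto
    let ?M = "add_mset 0 (add_mset 0 M)"
    have "cong (X 0 * X 1) (Y k 0 ^ 2)"
      using quadric' by (simp add: cong_def)
    then have "cong (Y_monomial k a b' M * (X 0 * X 1)) (Y_monomial k a b' M * Y k 0 ^ 2)"
      unfolding Y_monomial_def
      by (intro cong_mult coord_ring_mult_closed power_carrier X_carrier prod_Y_carrier) auto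
    then have c: "cong (Y_monomial k (Suc a) b M) (Y_monomial k a b' ?M)"
      by (simp add: Y_monomial_def b mult_ac power2_eq_square)
    have "set_mset ?M \<subseteq> {..k}" using Suc.prems by auto
    from Suc.IH[OF this, of b'] obtain a'' b'' M'' where *: "set_mset M'' \<subseteq> {..k}"
      "a'' + b'' + size M'' = a + b' + size ?M"
      "2 * k * a'' + Y_weight k M'' = 2 * k * a + Y_weight k ?M"
      "2 * k * b'' + Y_weight k M'' = 2 * k * b' + Y_weight k ?M"
      "a'' = 0 \<or> b'' = 0" "cong (Y_monomial k a b' ?M) (Y_monomial k a'' b'' M'')"
      by blast
    have "cong (Y_monomial k (Suc a) b M) (Y_monomial k a'' b'' M'')"
      using c *(6) by (rule cong_trans)
    moreover have "a'' + b'' + size M'' = Suc a + b + size M"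
      "2 * k * a'' + Y_weight k M'' = 2 * k * Suc a + Y_weight k M"
      "2 * k * b'' + Y_weight k M'' = 2 * k * b + Y_weight k M"
      using *(2-4) by (simp_all add: b)
    ultimately show ?thesis using *(1,5) by metis
  qed
qed

text \<open>The last two equations compare the exponents of \<open>x\<close> and \<open>y\<close> in the pull-backs of two
  \<^const>\<open>Y_monomial\<close>s; the exponents of \<open>z\<close> then agree by homogeneity.\<close>

definition same_pullback ::
    "nat \<Rightarrow> nat \<Rightarrow> nat \<Rightarrow> nat \<Rightarrow> nat multiset \<Rightarrow> nat \<Rightarrow> nat \<Rightarrow> nat multiset \<Rightarrow> bool" where
  "same_pullback d k a b M a' b' M' \<longleftrightarrow>
     a + b + size M = a' + b' + size M' \<and>
     d * a + Y_weight k M = d * a' + Y_weight k M' \<and>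
     d * b + Y_weight k M = d * b' + Y_weight k M'"

text \<open>The exponents of x and y in the pull-back differ by d (a - b), which fixes a - b for
  positive d.\<close>

lemma same_pullback_diff:
  assumes "same_pullback d k a b M a' b' M'" "d > 0"
  shows "a + b' = a' + b"
proof -
  have "d * (a + b') = d * (a' + b)"
    using assms(1) by (simp add: same_pullback_def distrib_left)
  then show ?thesis using assms(2) by simp
qed

lemma (in curve_ideal) even_cong:
  assumes quadric': "X 0 * X 1 - Y k 0 ^ 2 \<in> I" and "k > 0"
    and M: "set_mset M \<subseteq> {..k}" "set_mset M' \<subseteq> {..k}"
    and same: "same_pullback (2 * k) k a b M a' b' M'"
  shows "cong (Y_monomial k a b M) (Y_monomial k a' b' M')"
proof -
  from even_reduce[OF quadric' M(1), of a b]
  obtain a1 b1 M1 where 1: "set_mset M1 \<subseteq> {..k}" "a1 + b1 + size M1 = a + b + size M"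
    "2 * k * a1 + Y_weight k M1 = 2 * k * a + Y_weight k M"
    "2 * k * b1 + Y_weight k M1 = 2 * k * b + Y_weight k M"
    "a1 = 0 \<or> b1 = 0" "cong (Y_monomial k a b M) (Y_monomial k a1 b1 M1)" by blast
  from even_reduce[OF quadric' M(2), of a' b']
  obtain a2 b2 M2 where 2: "set_mset M2 \<subseteq> {..k}" "a2 + b2 + size M2 = a' + b' + size M'"
    "2 * k * a2 + Y_weight k M2 = 2 * k * a' + Y_weight k M'"
    "2 * k * b2 + Y_weight k M2 = 2 * k * b' + Y_weight k M'"
    "a2 = 0 \<or> b2 = 0" "cong (Y_monomial k a' b' M') (Y_monomial k a2 b2 M2)" by blast
  have s: "same_pullback (2 * k) k a1 b1 M1 a2 b2 M2"
    using same 1 2 by (simp add: same_pullback_def)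
  \<comment> \<open>Equal differences, together with a zero in each pair, force equal pairs; then
    the weights agree, and with them the index sums.\<close>
  then have "a1 + b2 = a2 + b1" using same_pullback_diff \<open>k > 0\<close> by simp
  then have ab: "a1 = a2" "b1 = b2" using 1(5) 2(5) by auto
  with s have sz: "size M1 = size M2" and "Y_weight k M1 = Y_weight k M2"
    by (auto simp: same_pullback_def)
  then have "\<Sum>\<^sub># M1 = \<Sum>\<^sub># M2"
    using Y_weight_plus_sum[OF 1(1)] Y_weight_plus_sum[OF 2(1)] by simp
  then have "cong (Y_monomial k a1 b1 M1) (Y_monomial k a2 b2 M2)"
    unfolding ab using sz 1 2 by (intro Y_monomial_cong prod_Y_cong)
  with 1(6) 2(6) show ?thesis by (meson cong_sym cong_trans)
qed

lemma (in curve_ideal) odd_cong: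
  assumes cubic: "\<And>i. i < k \<Longrightarrow> Y k i * Y k 0 ^ 2 - Y k (Suc i) * (X 0 * X 1) \<in> I"
    and M: "set_mset M \<subseteq> {..k}" "set_mset M' \<subseteq> {..k}"
    and same: "same_pullback (2 * k + 1) k a b M a' b' M'"
  shows "cong (Y_monomial k a b M) (Y_monomial k a' b' M')"
proof -
  from odd_reduce[OF cubic M(1), of a b]
  obtain a1 b1 M1 where 1: "set_mset M1 \<subseteq> {..k}" "a1 + b1 + size M1 = a + b + size M"
    "(2 * k + 1) * a1 + Y_weight k M1 = (2 * k + 1) * a + Y_weight k M"
    "(2 * k + 1) * b1 + Y_weight k M1 = (2 * k + 1) * b + Y_weight k M"
    "a1 = 0 \<or> b1 = 0 \<or> \<Sum>\<^sub># M1 = 0" "cong (Y_monomial k a b M) (Y_monomial k a1 b1 M1)" by blast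
  from odd_reduce[OF cubic M(2), of a' b']
  obtain a2 b2 M2 where 2: "set_mset M2 \<subseteq> {..k}" "a2 + b2 + size M2 = a' + b' + size M'"
    "(2 * k + 1) * a2 + Y_weight k M2 = (2 * k + 1) * a' + Y_weight k M'"
    "(2 * k + 1) * b2 + Y_weight k M2 = (2 * k + 1) * b' + Y_weight k M'"
    "a2 = 0 \<or> b2 = 0 \<or> \<Sum>\<^sub># M2 = 0" "cong (Y_monomial k a' b' M') (Y_monomial k a2 b2 M2)" by blast
  have s: "same_pullback (2 * k + 1) k a1 b1 M1 a2 b2 M2"
    using same 1 2 by (simp add: same_pullback_def)
  then have diff: "a1 + b2 = a2 + b1" using same_pullback_diff by simp
  have W: "Y_weight k M1 + \<Sum>\<^sub># M1 = k * size M1" "Y_weight k M2 + \<Sum>\<^sub># M2 = k * size M2"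
    using Y_weight_plus_sum 1(1) 2(1) by blast+
  have "a1 + \<Sum>\<^sub># M2 = a2 + \<Sum>\<^sub># M1"
  proof -
    \<comment> \<open>The integers admit the negative differences of this elimination: with D = a1 -
      a2 = b1 - b2 the sizes differ by -2 D, hence (2 k + 1) D - 2 k D = s1 - s2.\<close>
    define n1 n2 s1 s2 A1 A2 B1 B2 where "n1 = int (size M1)" "n2 = int (size M2)"
      "s1 = int (\<Sum>\<^sub># M1)" "s2 = int (\<Sum>\<^sub># M2)" "A1 = int a1" "A2 = int a2" "B1 = int b1" "B2 = int b2"
    note defs = this
    have "int (Y_weight k M1) = int k * n1 - s1" "int (Y_weight k M2) = int k * n2 - s2"
      using W[THEN arg_cong[of _ _ int]] by (simp_all add: defs)
    moreover have "(2 * int k + 1) * A1 + int (Y_weight k M1) = (2 * int k + 1) * A2 + int (Y_weight k M2)"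
      using s[unfolded same_pullback_def, THEN conjunct2, THEN conjunct1, THEN arg_cong[of _ _ int]]
      by (simp add: defs algebra_simps)
    ultimately have "(2 * int k + 1) * (A1 - A2) + int k * (n1 - n2) = s1 - s2"
      by (simp add: algebra_simps)
    moreover have "B1 - B2 = A1 - A2" using diff by (simp add: defs)
    then have "n1 - n2 = - 2 * (A1 - A2)"
      using s[unfolded same_pullback_def, THEN conjunct1, THEN arg_cong[of _ _ int]]
      by (simp add: defs)
    ultimately have "A1 - A2 = s1 - s2" by (simp add: algebra_simps)
    then show ?thesis unfolding defs by linarith
  qed
  \<comment> \<open>The triples (a, b, index sum) thus differ by a constant shift, and each contains
    a zero, so they coincide.\<close>
  with diff 1(5) 2(5) have ab: "a1 = a2" "b1 = b2" and sum: "\<Sum>\<^sub># M1 = \<Sum>\<^sub># M2"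
    by linarith+
  with s have sz: "size M1 = size M2" by (auto simp: same_pullback_def)
  have "cong (Y_monomial k a1 b1 M1) (Y_monomial k a2 b2 M2)"
    unfolding ab using sz sum 1 2 by (intro Y_monomial_cong prod_Y_cong)
  with 1(6) 2(6) show ?thesis by (meson cong_sym cong_trans)
qed

section \<open>The ideal of the surface\<close>

text \<open>The lift of the morphism to vectors, so that coordinates can be computed without
  choosing representatives of classes.\<close>

definition togliatti_point :: "nat \<Rightarrow> 'a::field vec \<Rightarrow> 'a vec" where
  "togliatti_point d u =
     vec (length (togliatti_gens d :: 'a mpoly list)) (\<lambda>j. mpoly_eval u (togliatti_gens d ! j))"

lemma length_togliatti_gens: "length (togliatti_gens d :: 'a::field mpoly list) = d div 2 + 3"
  by (simp add: togliatti_gens_def Let_def)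

lemma togliatti_point_carrier:
  "togliatti_point d u \<in> carrier_vec (d div 2 + 3)"
  unfolding togliatti_point_def length_togliatti_gens by (rule vec_carrier)

lemma togliatti_point_coords:
  assumes "d = 2 * k + \<epsilon>" "\<epsilon> \<in> {0, 1}"
  shows "togliatti_point d u $ 0 = (u $ 0) ^ d"
    and "togliatti_point d u $ 1 = (u $ 1) ^ d"
    and "i \<le> k \<Longrightarrow>
      togliatti_point d u $ Y_index k i = (u $ 0 * u $ 1) ^ (k - i) * (u $ 2) ^ (\<epsilon> + 2 * i)"
proof -
  have [simp]: "d div 2 = k" "d mod 2 = \<epsilon>" using assms by auto
  have nth: "togliatti_point d u $ j = mpoly_eval u (togliatti_gens d ! j)" if "j < k + 3" for j
    using that by (simp add: togliatti_point_def length_togliatti_gens)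
  show "togliatti_point d u $ 0 = (u $ 0) ^ d" "togliatti_point d u $ 1 = (u $ 1) ^ d"
    by (simp_all add: nth togliatti_gens_def Let_def)
  show "togliatti_point d u $ Y_index k i = (u $ 0 * u $ 1) ^ (k - i) * (u $ 2) ^ (\<epsilon> + 2 * i)"
    if "i \<le> k"
  \<comment> \<open>\<open>Y k k\<close> is x_2, which the generators list among the pure powers; it
    fits the pattern because \<open>\<epsilon> + 2 * k = d\<close>.\<close>
  proof (cases "i = k")
    case True
    have "togliatti_point d u $ 2 = (u $ 2) ^ d"
      by (simp add: nth togliatti_gens_def Let_def)
    then show ?thesis
      using True assms(1) by (simp add: Y_index_def add.commute)
  next
    case False
    then show ?thesis
      using that by (simp add: Y_index_def nth togliatti_gens_def Let_def nth_append power_mult_distrib)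
  qed
qed

text \<open>The scalar covers every representative of an image point, so a polynomial that vanishes
  on all these multiples vanishes on the variety.\<close>

lemma mem_togliatti_variety:
  assumes "P \<in> togliatti_variety d" "v \<in> P"
  shows "\<exists>c u. v = c \<cdot>\<^sub>v togliatti_point d u"
proof -
  from assms(1) obtain Q where "P = proj_map (togliatti_gens d) Q"
    by (auto simp: togliatti_variety_def togliatti_map_def)
  with assms(2) show ?thesis
    by (auto simp: proj_map_def proj_rel_def togliatti_point_def)
qed

text \<open>Supplies actual points of the variety at which a form in the ideal must vanish. On the
  curve used below the image is nonzero because its coordinate x_2 is 1.\<close>

lemma togliatti_point_mem:
  assumes u: "u \<in> nonzero_vecs 2" and "togliatti_point d u \<noteq> 0\<^sub>v (d div 2 + 3)"
  shows "\<exists>P\<in>togliatti_variety d. togliatti_point d u \<in> P"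
proof
  let ?Q = "proj_rel 2 `` {u}"
  have "?Q \<in> proj_space 2"
    using u by (simp add: proj_space_def quotientI)
  then show "togliatti_map d ?Q \<in> togliatti_variety d"
    by (simp add: togliatti_variety_def)
  have refl: "(w, w) \<in> proj_rel n" if "w \<in> nonzero_vecs n" for w :: "'a vec" and n
    using that by (auto simp: proj_rel_def intro!: exI[of _ 1])
  have "togliatti_point d u \<in> nonzero_vecs (d div 2 + 2)"
    using assms(2) togliatti_point_carrier[of d u] by (simp add: nonzero_vecs_def numeral_3_eq_3)
  then show "togliatti_point d u \<in> togliatti_map d ?Q"
    using refl[OF u] refl[of "togliatti_point d u"]
    by (auto simp: togliatti_map_def proj_map_def togliatti_point_def length_togliatti_gens)
qed

lemma mpoly_eval_Y_monomial:
  "mpoly_eval v (Y_monomial k a b M) = (v $ 0) ^ a * (v $ 1) ^ b * (\<Prod>i\<in>#M. v $ Y_index k i)"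
  by (simp add: Y_monomial_def Y_def)

text \<open>For forms of degree \<open>e\<close> and \<open>N > d e\<close> the curve \<open>t \<mapsto> (t, t\<^sup>N, 1)\<close> separates the exponents
  that occur, since in the pull-back the exponents of \<open>x\<close> and \<open>y\<close> are the digits of \<open>w\<close> in base \<open>N\<close>.\<close>

lemma homogeneous_ideal_togliatti:
  fixes G :: "'a::field_char_0 mpoly set"
  assumes d: "d = 2 * k + \<epsilon>" "\<epsilon> \<in> {0, 1}" and "k > 0"
    and forms: "G \<subseteq> (\<Union>e. forms (k + 2) e)"
    and van: "\<And>g c u. g \<in> G \<Longrightarrow> mpoly_eval (c \<cdot>\<^sub>v togliatti_point d u) g = 0"
    and cong: "\<And>a b M a' b' M'. set_mset M \<subseteq> {..k} \<Longrightarrow> set_mset M' \<subseteq> {..k} \<Longrightarrow>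
      same_pullback d k a b M a' b' M' \<Longrightarrow>
      poly_ideal.cong (Idl\<^bsub>coord_ring (k + 2)\<^esub> G) (Y_monomial k a b M) (Y_monomial k a' b' M')"
  shows "homogeneous_ideal (k + 2) (togliatti_variety d) = Idl\<^bsub>coord_ring (k + 2)\<^esub> G"
proof -
  let ?R = "coord_ring (k + 2) :: 'a mpoly ring"
  let ?V = "{f. (\<exists>e. f \<in> forms (k + 2) e) \<and>
    (\<forall>P\<in>togliatti_variety d. \<forall>v\<in>P. mpoly_eval v f = (0 :: 'a))}"
  have dk: "d div 2 = k" using d by auto
  interpret R: ring ?R by (rule cring.axioms(1)[OF cring_coord_ring])
  have G: "G \<subseteq> carrier ?R" using forms forms_subset_carrier by blast
  then interpret poly_ideal "k + 2" "Idl\<^bsub>?R\<^esub> G" by (rule poly_ideal_Idl)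
  have "G \<subseteq> ?V"
    using forms van mem_togliatti_variety by fastforce
  moreover have V: "?V \<subseteq> carrier ?R" using forms_subset_carrier by blast
  ultimately have "Idl\<^bsub>?R\<^esub> G \<subseteq> Idl\<^bsub>?R\<^esub> ?V"
    by (intro R.subset_Idl_subset) auto
  moreover have "?V \<subseteq> Idl\<^bsub>?R\<^esub> G"
  proof
    fix f assume "f \<in> ?V"
    then obtain e where f: "f \<in> forms (k + 2) e"
      and f0: "\<And>P v. P \<in> togliatti_variety d \<Longrightarrow> v \<in> P \<Longrightarrow> mpoly_eval v f = 0" by blast
    define N where "N = d * e + 1"
    define u :: "'a \<Rightarrow> 'a vec" where "u t = vec 3 (\<lambda>j. if j = 0 then t else if j = 1 then t ^ N else 1)" for t
    have u: "u t $ 0 = t" "u t $ 1 = t ^ N" "u t $ 2 = 1" for t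
      by (simp_all add: u_def)
    have u_carrier: "u t \<in> carrier_vec 3" for t by (simp add: u_def)
    have "u t \<noteq> 0\<^sub>v 3" for t
      using u(3)[of t] by auto
    with u_carrier have u_nz: "u t \<in> nonzero_vecs 2" for t
      by (simp add: nonzero_vecs_def)
    define p where "p t = togliatti_point d (u t)" for t
    have p: "p t $ 0 = t ^ d" "p t $ 1 = (t ^ N) ^ d"
      "\<And>i. i \<le> k \<Longrightarrow> p t $ Y_index k i = (t * t ^ N) ^ (k - i)" for t
      using togliatti_point_coords[OF d, where u = "u t"]
      by (simp_all add: p_def u u(2)[unfolded One_nat_def])
    have "p t \<noteq> 0\<^sub>v (k + 3)" for t
      using p(3)[of k t] by (auto simp: Y_index_def)
    then have fp: "mpoly_eval (p t) f = 0" for t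
      using togliatti_point_mem[OF u_nz, of d t] f0 by (auto simp: p_def dk)
    have pY: "(\<Prod>i\<in>#M. p t $ Y_index k i) = (t * t ^ N) ^ Y_weight k M" if "set_mset M \<subseteq> {..k}" for M t
      using that by (induction M) (auto simp: p(3) power_add[symmetric])
    define w where "w a b M = (d * a + Y_weight k M) + N * (d * b + Y_weight k M)" for a b M
    have pw: "mpoly_eval (p t) (Y_monomial k a b M) = t ^ w a b M" if "set_mset M \<subseteq> {..k}" for a b M t
      unfolding mpoly_eval_Y_monomial pY[OF that] p(1,2) w_def
      by (simp add: power_add power_mult power_mult_distrib distrib_left)
    have "\<exists>a b M. set_mset M \<subseteq> {..k} \<and> e = a + b + size M \<and>
        Poly_Mapping.single m 1 = (Y_monomial k a b M :: 'a mpoly)"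
      if "m \<in> Poly_Mapping.keys f" for m
    proof -
      have "Poly_Mapping.keys m \<subseteq> {..k + 2}" and e: "mon_degree m = e"
        using f that unfolding forms_def coord_ring_simps(1) by blast+
      from single_eq_Y_monomial[OF this(1), where 'a = 'a] show ?thesis unfolding e .
    qed
    then obtain a b M where abM: "\<And>m. m \<in> Poly_Mapping.keys f \<Longrightarrow> set_mset (M m) \<subseteq> {..k}"
      "\<And>m. m \<in> Poly_Mapping.keys f \<Longrightarrow> e = a m + b m + size (M m)"
      "\<And>m. m \<in> Poly_Mapping.keys f \<Longrightarrow>
        Poly_Mapping.single m 1 = (Y_monomial k (a m) (b m) (M m) :: 'a mpoly)"
      by metis
    \<comment> \<open>The exponent of x stays a digit in base \<open>N\<close>: since
      \<open>k \<le> d\<close>, each of the \<open>e\<close> factors contributes at most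
      \<open>d\<close>.\<close>
    have small: "d * a m + Y_weight k (M m) < N" if "m \<in> Poly_Mapping.keys f" for m
    proof -
      have "Y_weight k (M m) \<le> k * size (M m)"
        using Y_weight_plus_sum[OF abM(1)[OF that]] by simp
      also have "\<dots> \<le> d * size (M m)" using d by simp
      finally have "d * a m + Y_weight k (M m) \<le> d * (a m + size (M m))"
        by (simp add: distrib_left)
      also have "\<dots> \<le> d * e" using abM(2)[OF that] by (intro mult_left_mono) auto
      finally show ?thesis by (simp add: N_def)
    qed
    show "f \<in> Idl\<^bsub>?R\<^esub> G"
    proof (rule mem_if_vanishing_on_curve)
      show "infinite (UNIV :: 'a set)" by (rule infinite_UNIV_char_0)
      show "(\<Sum>m\<in>Poly_Mapping.keys f. Poly_Mapping.lookup f m * t ^ w (a m) (b m) (M m)) = 0" for t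
      proof -
        have "mon_eval (p t) m = t ^ w (a m) (b m) (M m)" if "m \<in> Poly_Mapping.keys f" for m
          using pw[OF abM(1)[OF that], of t] mpoly_eval_single[of "p t" m 1]
          by (simp add: abM(3)[OF that])
        then show ?thesis
          using fp[of t] by (simp add: mpoly_eval_superset[of "Poly_Mapping.keys f"])
      qed
      fix m m' assume m: "m \<in> Poly_Mapping.keys f" "m' \<in> Poly_Mapping.keys f"
        and "w (a m) (b m) (M m) = w (a m') (b m') (M m')"
      then have eq: "(d * a m + Y_weight k (M m)) + N * (d * b m + Y_weight k (M m)) =
        (d * a m' + Y_weight k (M m')) + N * (d * b m' + Y_weight k (M m'))"
        by (simp add: w_def)
      \<comment> \<open>Reduction modulo \<open>N\<close> compares the lower digits; cancelling them
        then compares the upper parts.\<close>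
      have "d * a m + Y_weight k (M m) = d * a m' + Y_weight k (M m')"
        using arg_cong[OF eq, of "\<lambda>x. x mod N"] small m by simp
      moreover from eq this
      have "N * (d * b m + Y_weight k (M m)) = N * (d * b m' + Y_weight k (M m'))" by linarith
      then have "d * b m + Y_weight k (M m) = d * b m' + Y_weight k (M m')"
        unfolding mult_cancel1 by (simp add: N_def)
      ultimately have "same_pullback d k (a m) (b m) (M m) (a m') (b m') (M m')"
        using abM(2)[OF m(1)] abM(2)[OF m(2)] by (simp add: same_pullback_def)
      then show "poly_ideal.cong (Idl\<^bsub>?R\<^esub> G) (Poly_Mapping.single m 1) (Poly_Mapping.single m' 1)"
        unfolding abM(3)[OF m(1)] abM(3)[OF m(2)] using abM(1) m by (intro cong)
    qed
  qed
  then have "Idl\<^bsub>?R\<^esub> ?V \<subseteq> Idl\<^bsub>?R\<^esub> G"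
    by (rule R.genideal_minimal[OF ideal])
  ultimately show ?thesis by (simp add: homogeneous_ideal_def)
qed

section \<open>Generators and minors\<close>

definition Y_quadrics :: "nat \<Rightarrow> 'a::field mpoly set" where
  "Y_quadrics k = {Y k i * Y k (Suc j) - Y k (Suc i) * Y k j | i j. i < j \<and> j < k}"

definition Y_cubics :: "nat \<Rightarrow> 'a::field mpoly set" where
  "Y_cubics k = {Y k i * Y k 0 ^ 2 - Y k (Suc i) * (X 0 * X 1) | i. i < k}"

lemma Y_quadrics_forms: "Y_quadrics k \<subseteq> forms (k + 2) 2"
  by (auto simp: Y_quadrics_def Y_def intro!: forms_diff X_mult_form Y_index_le[simplified])

lemma Y_cubics_forms: "Y_cubics k \<subseteq> forms (k + 2) 3"
  by (auto simp: Y_cubics_def Y_def power2_eq_square intro!: forms_diff X_mult3_form Y_index_le[simplified])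

section \<open>Distinctness of the generators\<close>

lemma Y_index_eq_iff: "i \<le> k \<Longrightarrow> j \<le> k \<Longrightarrow> Y_index k i = Y_index k j \<longleftrightarrow> i = j"
  by (auto simp: Y_index_def)

text \<open>At this point the first product is 1 only for the pair (i, j), where the second vanishes
  because i < j. Every other quadric takes the value 0 or -1, and -1 differs from 1 in
  characteristic zero. This separates the quadrics.\<close>

lemma Y_quadric_at_indicator:
  fixes v :: "'a::field_char_0 vec"
  assumes v: "v = vec (k + 3) (\<lambda>l. if l = Y_index k i \<or> l = Y_index k (Suc j) then 1 else 0)"
    and ij: "i < j" "j < k" "i' < j'" "j' < k"
  shows "mpoly_eval v (Y k i' * Y k (Suc j') - Y k (Suc i') * Y k j') = 1 \<longleftrightarrow> i' = i \<and> j' = j"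
proof -
  have [simp]: "v $ Y_index k l = (if l = i \<or> l = Suc j then 1 else 0)" if "l \<le> k" for l
    using that ij Y_index_le[of k l] by (simp add: v Y_index_eq_iff)
  show ?thesis using ij by (auto simp: Y_def)
qed

lemma card_Y_quadrics: "card (Y_quadrics k :: 'a::field_char_0 mpoly set) = k choose 2"
  and zero_notin_Y_quadrics: "(0 :: 'a::field_char_0 mpoly) \<notin> Y_quadrics k"
proof -
  let ?P = "{(i, j). i < j \<and> j < k}"
  let ?q = "\<lambda>(i, j). Y k i * Y k (Suc j) - Y k (Suc i) * Y k j :: 'a mpoly"
  let ?v = "\<lambda>i j. vec (k + 3) (\<lambda>l. if l = Y_index k i \<or> l = Y_index k (Suc j) then 1 else 0) :: 'a vec"
  have "inj_on ?q ?P"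
  proof (rule inj_onI, clarify)
    fix i j i' j' assume ij: "i < j" "j < k" "i' < j'" "j' < k"
      and eq: "Y k i * Y k (Suc j) - Y k (Suc i) * Y k j = (Y k i' * Y k (Suc j') - Y k (Suc i') * Y k j' :: 'a mpoly)"
    then have "mpoly_eval (?v i j) (Y k i' * Y k (Suc j') - Y k (Suc i') * Y k j') = 1"
      using Y_quadric_at_indicator[OF refl ij(1,2) ij(1,2), where 'a = 'a] unfolding eq[symmetric] by simp
    then show "i = i' \<and> j = j'"
      using Y_quadric_at_indicator[OF refl ij, where 'a = 'a] by simp
  qed
  moreover have "Y_quadrics k = ?q ` ?P"
    by (auto simp: Y_quadrics_def)
  ultimately have "card (Y_quadrics k :: 'a mpoly set) = card ?P"
    by (simp add: card_image)
  \<comment> \<open>Grouping the pairs by the larger entry \<open>j\<close> leaves \<open>j\<close>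
    choices for \<open>i\<close>; the converse puts \<open>j\<close> first.\<close>
  also have "?P = (SIGMA j:{..<k}. {..<j})\<inverse>" by auto
  also have "card \<dots> = k choose 2"
    by (simp add: card_inverse lessThan_atLeast0 Sum_Ico_nat choose_two)
  finally show "card (Y_quadrics k :: 'a mpoly set) = k choose 2" .
  show "(0 :: 'a mpoly) \<notin> Y_quadrics k"
  proof
    assume "(0 :: 'a mpoly) \<in> Y_quadrics k"
    then obtain i j where ij: "i < j" "j < k" "(0 :: 'a mpoly) = Y k i * Y k (Suc j) - Y k (Suc i) * Y k j"
      by (auto simp: Y_quadrics_def)
    show False
      using Y_quadric_at_indicator[OF refl ij(1,2) ij(1,2), where 'a = 'a] unfolding ij(3)[symmetric] by simp
  qed
qed

lemma finite_Y_quadrics: "finite (Y_quadrics k)"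
proof -
  have "Y_quadrics k \<subseteq> (\<lambda>(i, j). Y k i * Y k (Suc j) - Y k (Suc i) * Y k j) ` ({..<k} \<times> {..<k})"
    by (force simp: Y_quadrics_def)
  then show ?thesis by (rule finite_subset) simp
qed

lemma finite_Y_cubics: "finite (Y_cubics k)"
  by (simp add: Y_cubics_def)

lemma card_Y_cubics: "card (Y_cubics k :: 'a::field_char_0 mpoly set) = k"
  and zero_notin_Y_cubics: "(0 :: 'a::field_char_0 mpoly) \<notin> Y_cubics k"
proof -
  let ?c = "\<lambda>i. Y k i * Y k 0 ^ 2 - Y k (Suc i) * (X 0 * X 1) :: 'a mpoly"
  \<comment> \<open>At the point whose coordinate x_l is l, the term with x_0 vanishes and the cubic
    becomes 3^2 (i + 3), which is nonzero and separates the indices in characteristic zero.\<close>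
  define v :: "'a vec" where "v = vec (k + 3) of_nat"
  have v: "mpoly_eval v (?c i) = of_nat (9 * (i + 3))" if "i < k" for i
    using that by (simp add: v_def Y_def Y_index_def algebra_simps)
  have "inj_on ?c {..<k}"
  proof (rule inj_onI)
    fix i j assume ij: "i \<in> {..<k}" "j \<in> {..<k}" "?c i = ?c j"
    then have "of_nat (9 * (i + 3)) = (of_nat (9 * (j + 3)) :: 'a)"
      using v[of i] v[of j] by simp
    then show "i = j" unfolding of_nat_eq_iff by simp
  qed
  moreover have "Y_cubics k = ?c ` {..<k}" by (auto simp: Y_cubics_def)
  ultimately show "card (Y_cubics k :: 'a mpoly set) = k" by (simp add: card_image)
  show "(0 :: 'a mpoly) \<notin> Y_cubics k"
  proof
    assume "(0 :: 'a mpoly) \<in> Y_cubics k"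
    then obtain i where "i < k" "?c i = 0" by (auto simp: Y_cubics_def)
    then have "of_nat (9 * (i + 3)) = (0 :: 'a)" using v[of i] by simp
    then show False unfolding of_nat_eq_0_iff by simp
  qed
qed

section \<open>Two-by-two minors of matrices with two rows\<close>

lemma det_two:
  assumes "A \<in> carrier_mat 2 2"
  shows "det A = A $$ (0, 0) * A $$ (1, 1) - A $$ (0, 1) * A $$ (1, 0)"
proof -
  have "det (mat_delete A 0 j) = mat_delete A 0 j $$ (0, 0)" for j
    by (rule det_single) (use assms in \<open>auto simp: mat_delete_def\<close>)
  then show ?thesis
    using laplace_expansion_row[OF assms, of 0] assms
    by (simp add: numeral_2_eq_2 cofactor_def mat_delete_def)
qed

lemma det_submatrix_two_rows:
  assumes "dim_row M = 2" "i < j" "j < dim_col M"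
  shows "det (submatrix M {..<2} {i, j}) = M $$ (0, i) * M $$ (1, j) - M $$ (0, j) * M $$ (1, i)"
proof -
  let ?S = "submatrix M {..<2} {i, j}"
  \<comment> \<open>\<open>pick\<close> lists a set in increasing order, so positions 0 and 1 of
    \<open>{i, j}\<close> hold \<open>i\<close> and \<open>j\<close>.\<close>
  have pI: "pick {..<2} 0 = 0" "pick {..<2} (Suc 0) = 1"
    by (auto intro!: Least_equality)
  have pJ0: "pick {i, j} 0 = i"
    using assms by (auto intro!: Least_equality)
  then have pJ: "pick {i, j} 0 = i" "pick {i, j} (Suc 0) = j"
    using assms by (auto intro!: Least_equality)
  have r: "{l. l < dim_row M \<and> l \<in> {..<2}} = {0, 1}" using assms by auto
  have c: "{l. l < dim_col M \<and> l \<in> {i, j}} = {i, j}" using assms by auto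
  have "?S \<in> carrier_mat 2 2"
    using assms unfolding submatrix_def r c by (simp add: numeral_2_eq_2)
  then have "det ?S = ?S $$ (0, 0) * ?S $$ (1, 1) - ?S $$ (0, 1) * ?S $$ (1, 0)"
    by (rule det_two)
  also have "\<dots> = M $$ (0, i) * M $$ (1, j) - M $$ (0, j) * M $$ (1, i)"
    using assms unfolding submatrix_def r c by (simp add: pI pJ del: pick.simps)
  finally show ?thesis .
qed

lemma minors_two_rows:
  assumes "dim_row M = 2"
  shows "minors 2 M = {M $$ (0, i) * M $$ (1, j) - M $$ (0, j) * M $$ (1, i) | i j.
    i < j \<and> j < dim_col M}" (is "_ = ?R")
proof
  show "minors 2 M \<subseteq> ?R"
  proof
    fix x assume "x \<in> minors 2 M"
    then obtain I J where x: "x = det (submatrix M I J)" "I \<subseteq> {..<2}" "J \<subseteq> {..<dim_col M}"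
      "card I = 2" "card J = 2" by (auto simp: minors_def assms)
    have I: "I = {..<2}" using x by (intro card_subset_eq) auto
    obtain i j where "J = {i, j}" "i < j"
      using x(5) by (metis card_2_iff insert_commute linorder_neqE_nat)
    then show "x \<in> ?R" using x det_submatrix_two_rows[OF assms] unfolding I by auto
  qed
  show "?R \<subseteq> minors 2 M"
  proof clarify
    fix i j assume "i < j" "j < dim_col M"
    then show "M $$ (0, i) * M $$ (1, j) - M $$ (0, j) * M $$ (1, i) \<in> minors 2 M"
      unfolding minors_def using assms
      by (intro CollectI exI[of _ "{..<2}"] exI[of _ "{i, j}"]) (auto simp: det_submatrix_two_rows)
  qed
qed

lemma setcompr2_cong:
  assumes "\<And>i j. P i j \<Longrightarrow> f i j = g i j"
  shows "{f i j | i j. P i j} = {g i j | i j. P i j}"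
proof -
  have *: "{h i j | i j. P i j} = (\<lambda>(i, j). h i j) ` {(i, j). P i j}" for h by auto
  show ?thesis unfolding * by (rule image_cong) (auto simp: assms)
qed

text \<open>The final \<open>X 2\<close> of the second row is \<open>Y k k\<close>, which gives all
  columns the uniform shape (y_j, y_{j+1}).\<close>

lemma mat_B_nth:
  assumes "j < k"
  shows "mat_B k $$ (0, j) = Y k j" "mat_B k $$ (1, j) = Y k (Suc j)"
  using assms by (auto simp: mat_B_def mat_of_rows_list_def Y_def Y_index_def nth_append add.commute)

lemma minors_mat_B: "minors 2 (mat_B k) = Y_quadrics k"
proof -
  have dim: "dim_row (mat_B k) = 2" "dim_col (mat_B k) = k"
    by (simp_all add: mat_B_def mat_of_rows_list_def)
  show ?thesis
    unfolding minors_two_rows[OF dim(1)] dim(2) Y_quadrics_def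
    by (rule setcompr2_cong) (auto simp: mat_B_nth[unfolded One_nat_def] mult.commute)
qed

lemma mat_A_nth:
  assumes "k > 0"
  shows "j < k \<Longrightarrow> mat_A k $$ (0, j) = Y k j" "j < k \<Longrightarrow> mat_A k $$ (1, j) = Y k (Suc j)"
    "mat_A k $$ (0, k) = X 0 * X 1" "mat_A k $$ (1, k) = Y k 0 ^ 2"
  using assms
  by (auto simp: mat_A_def mat_of_rows_list_def Y_def Y_index_def nth_append add.commute nth_Cons')

text \<open>Two columns of the \<open>B\<close> part give a quadric; one of them together with the
  last column gives a cubic.\<close>

lemma minors_mat_A:
  assumes "k > 0"
  shows "minors 2 (mat_A k) = Y_quadrics k \<union> Y_cubics k"
proof -
  have dim: "dim_row (mat_A k) = 2" "dim_col (mat_A k) = k + 1"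
    by (simp_all add: mat_A_def mat_of_rows_list_def)
  let ?m = "\<lambda>i j. mat_A k $$ (0, i) * mat_A k $$ (1, j) - mat_A k $$ (0, j) * mat_A k $$ (1, i)"
  have q: "?m i j = Y k i * Y k (Suc j) - Y k (Suc i) * Y k j" if "i < j" "j < k" for i j
    using that by (simp add: mat_A_nth[OF assms, unfolded One_nat_def] mult.commute)
  have c: "?m i k = Y k i * Y k 0 ^ 2 - Y k (Suc i) * (X 0 * X 1)" if "i < k" for i
    using that by (simp add: mat_A_nth[OF assms, unfolded One_nat_def] mult.commute)
  have "minors 2 (mat_A k) = {?m i j | i j. i < j \<and> j < k} \<union> {?m i k | i. i < k}"
    unfolding minors_two_rows[OF dim(1)] dim(2) by (auto simp: less_Suc_eq)
  also have "{?m i j | i j. i < j \<and> j < k} = Y_quadrics k"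
    unfolding Y_quadrics_def by (rule setcompr2_cong) (use q in auto)
  also have "{?m i k | i. i < k} = Y_cubics k"
    unfolding Y_cubics_def setcompr_eq_image by (rule image_cong) (use c in auto)
  finally show ?thesis .
qed

section \<open>Generated ideals and vanishing on the surface\<close>

lemma curve_ideal_Idl:
  assumes "Y_quadrics k \<subseteq> G" "G \<subseteq> carrier (coord_ring (k + 2))"
  shows "curve_ideal k (Idl\<^bsub>coord_ring (k + 2)\<^esub> G)"
proof -
  interpret poly_ideal "k + 2" "Idl\<^bsub>coord_ring (k + 2)\<^esub> G" by (rule poly_ideal_Idl) (rule assms)
  have "Y_quadrics k \<subseteq> Idl\<^bsub>coord_ring (k + 2)\<^esub> G"
    using assms ring.genideal_self[OF cring.axioms(1)[OF cring_coord_ring] assms(2)] by blast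
  then show ?thesis
    by unfold_locales (auto simp: Y_quadrics_def)
qed

text \<open>Both products pull back to (x y)^(2k-i-j-1) z^(2\<epsilon>+2(i+j+1)): only the index sum
  i + j + 1 matters, and the scalar enters as c^2 in both.\<close>

lemma Y_quadric_vanishes:
  assumes "d = 2 * k + \<epsilon>" "\<epsilon> \<in> {0, 1}" "g \<in> Y_quadrics k"
  shows "mpoly_eval (c \<cdot>\<^sub>v togliatti_point d u) g = 0"
proof -
  have k: "d div 2 = k" using assms by auto
  have Y: "(c \<cdot>\<^sub>v togliatti_point d u) $ Y_index k i =
      c * ((u $ 0 * u $ 1) ^ (k - i) * (u $ 2) ^ (\<epsilon> + 2 * i))" if "i \<le> k" for i
    using togliatti_point_coords(3)[OF assms(1,2) that, of u] togliatti_point_carrier[of d u]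
      Y_index_le[of k i] by (simp add: k)
  from assms(3) obtain i j where ij: "i < j" "j < k"
    "g = Y k i * Y k (Suc j) - Y k (Suc i) * Y k j" by (auto simp: Y_quadrics_def)
  have "k - i = Suc (k - Suc i)" "k - j = Suc (k - Suc j)" using ij by auto
  then show ?thesis using ij by (simp add: Y_def Y power_add)
qed

text \<open>Both terms pull back to (x y)^(3k-i) z^(2i+3).\<close>

lemma Y_cubic_vanishes:
  assumes "d = 2 * k + 1" "g \<in> Y_cubics k"
  shows "mpoly_eval (c \<cdot>\<^sub>v togliatti_point d u) g = 0"
proof -
  have k: "d div 2 = k" using assms by auto
  note coords = togliatti_point_coords[OF assms(1), where u = u]
  have dim: "togliatti_point d u \<in> carrier_vec (k + 3)"
    using togliatti_point_carrier[of d u] by (simp add: k)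
  have Y: "(c \<cdot>\<^sub>v togliatti_point d u) $ Y_index k i =
      c * ((u $ 0 * u $ 1) ^ (k - i) * (u $ 2) ^ (1 + 2 * i))" if "i \<le> k" for i
    using coords(3)[OF _ that] dim Y_index_le[of k i] by simp
  have X: "(c \<cdot>\<^sub>v togliatti_point d u) $ 0 = c * (u $ 0) ^ d"
    "(c \<cdot>\<^sub>v togliatti_point d u) $ 1 = c * (u $ 1) ^ d"
    "(c \<cdot>\<^sub>v togliatti_point d u) $ Suc 0 = c * (u $ 1) ^ d"
    using coords(1,2) dim by simp_all
  from assms(2) obtain i where i: "i < k" "g = Y k i * Y k 0 ^ 2 - Y k (Suc i) * (X 0 * X 1)"
    by (auto simp: Y_cubics_def)
  have "k - i = Suc (k - Suc i)" using i by auto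
  moreover have "a ^ d = a * (a ^ k * a ^ k)" for a :: 'a
    by (simp add: assms(1) mult_2 power_add)
  ultimately show ?thesis using i
    by (simp add: Y_def Y X power_mult_distrib power2_eq_square)
qed

text \<open>Both terms pull back to (x y)^(2k), since for even d the coordinate y_0 pulls back to (x
  y)^k.\<close>

lemma even_quadric_vanishes:
  assumes "d = 2 * k"
  shows "mpoly_eval (c \<cdot>\<^sub>v togliatti_point d u) (X 0 * X 1 - Y k 0 ^ 2) = 0"
proof -
  have k: "d div 2 = k" and d0: "d = 2 * k + 0" using assms by auto
  note coords = togliatti_point_coords[OF d0, where u = u]
  have dim: "togliatti_point d u \<in> carrier_vec (k + 3)"
    using togliatti_point_carrier[of d u] by (simp add: k)
  have Y: "(c \<cdot>\<^sub>v togliatti_point d u) $ Y_index k 0 = c * (u $ 0 * u $ 1) ^ k"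
    using coords(3)[of 0] dim Y_index_le[of k 0] by simp
  have X: "(c \<cdot>\<^sub>v togliatti_point d u) $ 0 = c * (u $ 0) ^ d"
    "(c \<cdot>\<^sub>v togliatti_point d u) $ Suc 0 = c * (u $ 1) ^ d"
    using coords(1,2) dim by simp_all
  have "a ^ d = a ^ k * a ^ k" for a :: 'a
    by (simp add: assms mult_2 power_add)
  then show ?thesis
    by (simp add: Y_def Y X power_mult_distrib power2_eq_square)
qed

section \<open>The two parities of d\<close>

theorem theorem7p2:
  fixes d k \<epsilon> :: nat
    and S :: "'a::{alg_closed_field, field_char_0} vec set set"
    and I_S :: "'a mpoly set"
  assumes "d \<ge> 3" and "d = 2 * k + \<epsilon>" and "\<epsilon> \<in> {0, 1}"
    and "S = togliatti_variety d"
    and "I_S = homogeneous_ideal (k + 2) S"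
  shows "(d = 2 * k + 1 \<longrightarrow>
            I_S = minors_ideal (k + 2) 2 (mat_A k) \<and>
            (\<exists>Q C. finite Q \<and> Q \<subseteq> forms (k + 2) 2 - {0} \<and> card Q = k choose 2 \<and>
                   finite C \<and> C \<subseteq> forms (k + 2) 3 - {0} \<and> card C = k \<and>
                   I_S = Idl\<^bsub>coord_ring (k + 2)\<^esub> (Q \<union> C))) \<and>
         (d = 2 * k \<longrightarrow>
            I_S = minors_ideal (k + 2) 2 (mat_B k)
                    <+>\<^bsub>coord_ring (k + 2)\<^esub> Idl\<^bsub>coord_ring (k + 2)\<^esub> {X 0 * X 1 - X 3 ^ 2} \<and>
            (\<exists>Q. finite Q \<and> Q \<subseteq> forms (k + 2) 2 - {0} \<and> card Q = 1 + (k choose 2) \<and>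
                 I_S = Idl\<^bsub>coord_ring (k + 2)\<^esub> Q))"
proof (intro conjI impI)
  let ?R = "coord_ring (k + 2) :: 'a mpoly ring"
  have k: "k > 0" using assms(1-3) by auto
  interpret R: ring ?R by (rule cring.axioms(1)[OF cring_coord_ring])
  {
    assume d: "d = 2 * k + 1"
    let ?G = "Y_quadrics k \<union> Y_cubics k :: 'a mpoly set"
    have forms: "?G \<subseteq> (\<Union>e. forms (k + 2) e)"
      using Y_quadrics_forms Y_cubics_forms by blast
    then have G: "?G \<subseteq> carrier ?R" using forms_subset_carrier by blast
    then interpret curve_ideal k "Idl\<^bsub>?R\<^esub> ?G" by (intro curve_ideal_Idl) auto
    have cubic: "Y k i * Y k 0 ^ 2 - Y k (Suc i) * (X 0 * X 1) \<in> Idl\<^bsub>?R\<^esub> ?G" if "i < k" for i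
      using that R.genideal_self[OF G] by (auto simp: Y_cubics_def)
    have "homogeneous_ideal (k + 2) (togliatti_variety d) = Idl\<^bsub>?R\<^esub> ?G"
      using odd_cong[OF cubic] Y_quadric_vanishes[OF d] Y_cubic_vanishes[OF d] d
      by (intro homogeneous_ideal_togliatti[OF d _ k forms]) auto
    then have I: "I_S = Idl\<^bsub>?R\<^esub> ?G" using assms(4,5) by simp
    show "I_S = minors_ideal (k + 2) 2 (mat_A k)"
      unfolding I minors_ideal_def minors_mat_A[OF k] ..
    show "\<exists>Q C. finite Q \<and> Q \<subseteq> forms (k + 2) 2 - {0} \<and> card Q = k choose 2 \<and>
       finite C \<and> C \<subseteq> forms (k + 2) 3 - {0} \<and> card C = k \<and> I_S = Idl\<^bsub>?R\<^esub> (Q \<union> C)"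
      using Y_quadrics_forms[of k] Y_cubics_forms[of k] zero_notin_Y_quadrics zero_notin_Y_cubics
      by (intro exI[of _ "Y_quadrics k"] exI[of _ "Y_cubics k"])
        (auto simp: I finite_Y_quadrics finite_Y_cubics card_Y_quadrics card_Y_cubics)
  }
  {
    assume d: "d = 2 * k"
    then have d0: "d = 2 * k + 0" by simp
    let ?g = "X 0 * X 1 - X 3 ^ 2 :: 'a mpoly"
    let ?G = "insert ?g (Y_quadrics k)"
    have X3: "X 3 = (Y k 0 :: 'a mpoly)" using k by (simp add: Y_def Y_index_def)
    have g: "?g \<in> forms (k + 2) 2"
      using k unfolding power2_eq_square by (intro forms_diff X_mult_form) auto
    have forms: "?G \<subseteq> (\<Union>e. forms (k + 2) e)"
      using Y_quadrics_forms g by blast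
    then have G: "?G \<subseteq> carrier ?R" using forms_subset_carrier by blast
    then interpret curve_ideal k "Idl\<^bsub>?R\<^esub> ?G" by (intro curve_ideal_Idl) auto
    have quadric': "X 0 * X 1 - Y k 0 ^ 2 \<in> Idl\<^bsub>?R\<^esub> ?G"
      using R.genideal_self[OF G] by (auto simp: X3)
    have "homogeneous_ideal (k + 2) (togliatti_variety d) = Idl\<^bsub>?R\<^esub> ?G"
      using even_cong[OF quadric' k] Y_quadric_vanishes[OF d0] even_quadric_vanishes[OF d] d
      by (intro homogeneous_ideal_togliatti[OF d0 _ k forms]) (auto simp: X3)
    then have I: "I_S = Idl\<^bsub>?R\<^esub> ?G" using assms(4,5) by simp
    have QR: "Y_quadrics k \<subseteq> carrier ?R" and gR: "{?g} \<subseteq> carrier ?R" using G by auto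
    \<comment> \<open>\<open>union_genideal\<close> describes the sum of two ideals as the ideal
      generated by their union, so both generating sets are first replaced by the ideals they
      generate.\<close>
    have "Idl\<^bsub>?R\<^esub> ?G = Idl\<^bsub>?R\<^esub> (Idl\<^bsub>?R\<^esub> (Y_quadrics k) \<union> Idl\<^bsub>?R\<^esub> {?g})"
    proof
      let ?J = "Idl\<^bsub>?R\<^esub> (Y_quadrics k) \<union> Idl\<^bsub>?R\<^esub> {?g}"
      have "?J \<subseteq> carrier ?R"
        using ideal.Icarr[OF R.genideal_ideal[OF QR]] ideal.Icarr[OF R.genideal_ideal[OF gR]] by blast
      moreover have "?G \<subseteq> ?J"
        using R.genideal_self[OF QR] R.genideal_self[OF gR] by blast
      ultimately show "Idl\<^bsub>?R\<^esub> ?G \<subseteq> Idl\<^bsub>?R\<^esub> ?J" by (intro R.subset_Idl_subset)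
      have "?J \<subseteq> Idl\<^bsub>?R\<^esub> ?G"
        using G by (intro Un_least R.subset_Idl_subset) auto
      then show "Idl\<^bsub>?R\<^esub> ?J \<subseteq> Idl\<^bsub>?R\<^esub> ?G" by (intro R.genideal_minimal ideal)
    qed
    also have "\<dots> = Idl\<^bsub>?R\<^esub> (Y_quadrics k) <+>\<^bsub>?R\<^esub> Idl\<^bsub>?R\<^esub> {?g}"
      by (intro R.union_genideal R.genideal_ideal QR gR)
    finally show "I_S = minors_ideal (k + 2) 2 (mat_B k) <+>\<^bsub>?R\<^esub> Idl\<^bsub>?R\<^esub> {?g}"
      unfolding I minors_ideal_def minors_mat_B .
    \<comment> \<open>At x_0 = x_1 = 1 with all other coordinates zero the extra quadric is 1 while
      every minor of \<open>B\<close> vanishes, so adding it raises the count by exactly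
      one.\<close>
    define v :: "'a vec" where "v = vec (k + 3) (\<lambda>l. if l < 2 then 1 else 0)"
    have "mpoly_eval v ?g = 1" using k by (simp add: v_def)
    moreover have "mpoly_eval v q = 0" if "q \<in> Y_quadrics k" for q
      using that by (auto simp: Y_quadrics_def Y_def Y_index_def v_def)
    ultimately have "?g \<notin> Y_quadrics k" "?g \<noteq> 0"
      using mpoly_eval_zero[of v] by (metis zero_neq_one)+
    then show "\<exists>Q. finite Q \<and> Q \<subseteq> forms (k + 2) 2 - {0} \<and> card Q = 1 + (k choose 2) \<and>
        I_S = Idl\<^bsub>?R\<^esub> Q"
      using Y_quadrics_forms[of k] zero_notin_Y_quadrics g
      by (intro exI[of _ ?G]) (auto simp: I finite_Y_quadrics card_Y_quadrics)
  }
qed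

end
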